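(* Let $f$ be a convex function with $f(0)=0$ that is strictly increasing on $\mathbb{R}^+$, and for a connected graph $G$ let $\mathrm{W}_f(G)=\sum_{\{u,v\}\subset V(G)} f(d(u,v))$. If $G$ is a connected graph of order $n$ with independence number $\alpha$ satisfying $n-1\ge\alpha\ge\frac n2$, then $\mathrm{W}_f(G)\le\mathrm{W}_f(\mathcal{A}_{n,n-\alpha})$, with equality if and only if $G\cong\mathcal{A}_{n,n-\alpha}$.
   Context: $d(u,v)$ is the graph distance and the sum runs over unordered pairs of distinct vertices. The independence number is the size of a largest independent vertex set. For integers $n,m$, $\mathcal{A}_{n,m}$ is the tree obtained from a path on $2m-1$ vertices by attaching $\lceil \frac{n-2m+1}{2}\rceil$ new pendent vertices to one end vertex of the path and $\lfloor \frac{n-2m+1}{2}\rfloor$ new pendent vertices to the other end vertex (for $n=2m$ it is the path on $2m$ vertices). *)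

theory Defs
  imports "HOL-Analysis.Convex" "Graph_Theory.Graph_Theory"
begin

text \<open>
  Finite simple graphs are \<^locale>\<open>pair_graph\<close>s: finite, loop-free digraphs on ordered pairs with a
  symmetric arc set, an edge \<open>uv\<close> being the two arcs \<open>(u, v)\<close> and \<open>(v, u)\<close>.
\<close>

definition gdist :: "'a pair_pre_digraph \<Rightarrow> 'a \<Rightarrow> 'a \<Rightarrow> real" where
  "gdist G u v = real_of_ereal (wf_digraph.\<mu> (with_proj G) (\<lambda>_. 1) u v)"

text \<open>
  The distance as a function of an unordered pair; it is well defined in a symmetric graph, see
  \<open>pair_dist_doubleton\<close> below.
\<close>

definition pair_dist :: "'a pair_pre_digraph \<Rightarrow> 'a set \<Rightarrow> real" where
  "pair_dist G e = (THE d. \<exists>u v. e = {u, v} \<and> d = gdist G u v)"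

definition wiener :: "(real \<Rightarrow> real) \<Rightarrow> 'a pair_pre_digraph \<Rightarrow> real" where
  "wiener f G = (\<Sum>e | e \<subseteq> pverts G \<and> card e = 2. f (pair_dist G e))"

definition independent_set :: "'a pair_pre_digraph \<Rightarrow> 'a set \<Rightarrow> bool" where
  "independent_set G S \<longleftrightarrow> S \<subseteq> pverts G \<and> (\<forall>u\<in>S. \<forall>v\<in>S. (u, v) \<notin> parcs G)"

definition independence_number :: "'a pair_pre_digraph \<Rightarrow> nat" where
  "independence_number G = Max (card ` {S. independent_set G S})"

text \<open>
  The tree \<open>A\<^sub>n\<^sub>,\<^sub>m\<close>, meaningful for \<open>m \<ge> 1\<close> and \<open>n \<ge> 2m\<close>: the path is \<open>0, 1, \<dots>, 2m - 2\<close>; the next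
  \<open>p\<close> vertices are pendent at \<open>0\<close> and the last \<open>q\<close> vertices are pendent at \<open>2m - 2\<close>.  For \<open>m = 1\<close>
  the two ends of the path coincide and the tree is a star.
\<close>

definition A_tree :: "nat \<Rightarrow> nat \<Rightarrow> nat pair_pre_digraph" where
  "A_tree n m =
    (let k = 2 * m - 1;
         p = nat \<lceil>(real n - 2 * real m + 1) / 2\<rceil>;
         q = nat \<lfloor>(real n - 2 * real m + 1) / 2\<rfloor>;
         E = {(i, i + 1) | i. i + 1 < k}
           \<union> {(0, j) | j. k \<le> j \<and> j < k + p}
           \<union> {(k - 1, j) | j. k + p \<le> j \<and> j < k + p + q}
     in \<lparr>pverts = {..<k + p + q}, parcs = E \<union> E\<inverse>\<rparr>)"

lemma pverts_A_tree:
  assumes "1 \<le> m" "2 * m \<le> n"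
  shows "pverts (A_tree n m) = {..<n}"
proof -
  define z where "z = int n - 2 * int m + 1"
  have z: "(real n - 2 * real m + 1) / 2 = real_of_int z / real_of_int 2"
    by (simp add: z_def)
  have fl: "\<lfloor>(real n - 2 * real m + 1) / 2\<rfloor> = z div 2"
    unfolding z by (rule floor_divide_of_int_eq)
  have ce: "\<lceil>(real n - 2 * real m + 1) / 2\<rceil> = - ((- z) div 2)"
    unfolding z by (rule ceiling_divide_eq_div)
  have "2 * m - 1 + nat (- ((- z) div 2)) + nat (z div 2) = n"
    using assms unfolding z_def by linarith
  then show ?thesis
    unfolding A_tree_def Let_def fl ce by simp
qed

lemma pair_graph_A_tree:
  assumes "1 \<le> m" "2 * m \<le> n"
  shows "pair_graph (A_tree n m)"
proof -
  let ?G = "A_tree n m"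
  have wf: "u \<in> pverts ?G \<and> v \<in> pverts ?G \<and> u \<noteq> v \<and> (v, u) \<in> parcs ?G"
    if "(u, v) \<in> parcs ?G" for u v
  proof -
    define p q where "p = nat \<lceil>(real n - 2 * real m + 1) / 2\<rceil>"
      and "q = nat \<lfloor>(real n - 2 * real m + 1) / 2\<rfloor>"
    show ?thesis
      using that assms
      unfolding A_tree_def Let_def p_def[symmetric] q_def[symmetric] by auto
  qed
  have fin: "finite (pverts ?G)"
    by (simp add: pverts_A_tree[OF assms])
  have "parcs ?G \<subseteq> pverts ?G \<times> pverts ?G"
    using wf by auto
  then have "finite (parcs ?G)"
    using fin finite_subset by blast
  then show ?thesis
    using wf fin by unfold_locales (auto simp: symmetric_def intro!: symI)
qed

lemma gdist_commute:
  assumes "pair_graph G"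
  shows "gdist G u v = gdist G v u"
proof -
  interpret pair_graph G by fact
  have rev: "\<exists>q. awalk v q u \<and> length q = length p" if "awalk u p v" for u v p
    using that
  proof (induction p arbitrary: u)
    case Nil
    then show ?case by (auto simp: awalk_Nil_iff)
  next
    case (Cons e p)
    then have e: "e \<in> parcs G" "fst e = u" and p: "awalk (snd e) p v"
      by (auto simp: awalk_Cons_iff)
    from Cons.IH[OF p] obtain q where q: "awalk v q (snd e)" "length q = length p" by blast
    have "(snd e, fst e) \<in> parcs G"
      using e pair_sym_arcs by (metis arcs_symmetric prod.collapse)
    then have "awalk (snd e) [(snd e, u)] u"
      using e by (auto simp: awalk_Cons_iff awalk_Nil_iff)
    then have "awalk v (q @ [(snd e, u)]) u"
      using q(1) by (rule awalk_appendI[rotated])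
    with q(2) show ?case by (intro exI[of _ "q @ [(snd e, u)]"]) simp
  qed
  have cost: "awalk_cost (\<lambda>_. 1) p = real (length p)" for p :: "('a \<times> 'a) awalk"
    by (induction p) (simp_all add: awalk_cost_def)
  have "(\<lambda>p. ereal (awalk_cost (\<lambda>_. 1) p)) ` {p. awalk u p v}
      = (\<lambda>p. ereal (awalk_cost (\<lambda>_. 1) p)) ` {p. awalk v p u}" (is "?f ` ?A = ?f ` ?B")
  proof -
    have "?f ` {p. awalk x p y} \<subseteq> ?f ` {p. awalk y p x}" for x y
    proof
      fix c assume "c \<in> ?f ` {p. awalk x p y}"
      then obtain p where p: "awalk x p y" "c = ?f p" by blast
      from rev[OF p(1)] obtain q where "awalk y q x" "length q = length p" by blast
      then show "c \<in> ?f ` {p. awalk y p x}"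
        using p(2) by (intro image_eqI[of _ _ q]) (simp_all add: cost)
    qed
    then show ?thesis by (intro equalityI)
  qed
  then show ?thesis
    unfolding gdist_def \<mu>_def by simp
qed

lemma pair_dist_doubleton:
  assumes "pair_graph G"
  shows "pair_dist G {u, v} = gdist G u v"
  unfolding pair_dist_def
  by (rule the_equality) (auto simp: doubleton_eq_iff gdist_commute[OF assms])

end

theory Submission
  imports Defs
begin

text \<open>
  Let \<open>m = n - \<alpha>\<close>.  The complement of a maximum independent set is a vertex cover of size \<open>m\<close>, and
  it is contained in a connected vertex set \<open>K\<close> of size \<open>k = 2m - 1\<close>; the remaining \<open>l = n - k\<close>
  vertices form an independent set \<open>L\<close>, and each of them has a neighbour in \<open>K\<close>.  The sum over all
  pairs of vertices splits into three parts, each of which is largest for the tree \<open>A\<close>: the pairs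
  inside \<open>K\<close> contribute at most as much as on a path; a vertex of \<open>L\<close> has distances at most
  \<open>1, \<dots>, k\<close> to \<open>K\<close>; and for the pairs inside \<open>L\<close> convexity replaces \<open>f\<close> on \<open>[2, k + 1]\<close> by its
  chord, which leaves a sum of distances to which each of the \<open>k - 1\<close> edges of a spanning tree of \<open>K\<close>
  contributes at most \<open>\<lfloor>l\<^sup>2 / 4\<rfloor>\<close>.  Equality in the second part forces \<open>K\<close> to be a path with \<open>L\<close>
  attached to its ends, and equality in the third part forces the ends to be balanced.
\<close>

section \<open>Distances in finite connected graphs\<close>

text \<open>Walks are encoded as relation powers, so distance arguments become inductions on a
  natural number; \<open>gdist_eq_rdist\<close> gives the link to \<open>gdist\<close>. The value is
  meaningful only for reachable pairs, since \<open>LEAST\<close> is otherwise unspecified.\<close>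

definition rdist :: "('a \<times> 'a) set \<Rightarrow> 'a \<Rightarrow> 'a \<Rightarrow> nat" where
  "rdist E u v = (LEAST n. (u, v) \<in> E ^^ n)"

lemma rdist_le: "(u, v) \<in> E ^^ n \<Longrightarrow> rdist E u v \<le> n"
  unfolding rdist_def by (rule Least_le)

lemma rdist_self [simp]: "rdist E u u = 0"
  using rdist_le[of u u 0 E] by simp

lemma relpow_sym:
  assumes "sym E" and "(u, v) \<in> E ^^ n"
  shows "(v, u) \<in> E ^^ n"
  using assms(2)
proof (induction n arbitrary: v)
  case 0
  then show ?case by simp
next
  case (Suc n)
  then obtain w where "(u, w) \<in> E ^^ n" "(w, v) \<in> E" by auto
  with Suc.IH assms(1) show ?case by (metis relpow_Suc_I2 symE)
qed

lemma rdist_commute: "sym E \<Longrightarrow> rdist E u v = rdist E v u"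
  unfolding rdist_def by (metis relpow_sym)

locale connected_ugraph =
  fixes V :: "'a set" and E :: "('a \<times> 'a) set"
  assumes finite_V: "finite V" and E_subset: "E \<subseteq> V \<times> V" and sym_E: "sym E"
    and no_loop: "(u, u) \<notin> E"
    and reach: "u \<in> V \<Longrightarrow> v \<in> V \<Longrightarrow> (u, v) \<in> E\<^sup>*"
begin

abbreviation d where "d \<equiv> rdist E"

lemma E_commute: "(u, v) \<in> E \<longleftrightarrow> (v, u) \<in> E"
  using sym_E by (meson symE)

lemma d_commute: "d u v = d v u"
  by (rule rdist_commute[OF sym_E])

lemma relpow_d: "u \<in> V \<Longrightarrow> v \<in> V \<Longrightarrow> (u, v) \<in> E ^^ d u v"
  unfolding rdist_def using reach rtrancl_imp_relpow by (metis LeastI_ex)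

lemma d_triangle:
  assumes "u \<in> V" "v \<in> V" "w \<in> V"
  shows "d u w \<le> d u v + d v w"
  by (rule rdist_le) (use relpow_d assms in \<open>auto simp: relpow_add\<close>)

lemma d_adj_le: "(u, v) \<in> E \<Longrightarrow> d u v \<le> 1"
  by (rule rdist_le) simp

lemma d_eq_0: "u \<in> V \<Longrightarrow> v \<in> V \<Longrightarrow> d u v = 0 \<Longrightarrow> u = v"
  using relpow_d[of u v] by simp

lemma d_pos: "u \<in> V \<Longrightarrow> v \<in> V \<Longrightarrow> u \<noteq> v \<Longrightarrow> 1 \<le> d u v"
  using d_eq_0[of u v] by linarith

lemma d_eq_1: "u \<in> V \<Longrightarrow> v \<in> V \<Longrightarrow> d u v = 1 \<longleftrightarrow> (u, v) \<in> E"
proof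
  assume "u \<in> V" "v \<in> V" "d u v = 1"
  then show "(u, v) \<in> E" using relpow_d[of u v] by simp
next
  assume V: "u \<in> V" "v \<in> V" and "(u, v) \<in> E"
  then have "u \<noteq> v" "d u v \<le> 1" using no_loop d_adj_le by auto
  with d_pos[OF V] show "d u v = 1" by simp
qed

lemma d_adj_step:
  assumes "(a, z) \<in> E" "w \<in> V"
  shows "d z w \<le> Suc (d a w)"
  using d_triangle[of z a w] d_adj_le[of z a] assms E_subset E_commute[of a z] by fastforce

text \<open>A walk that starts in \<open>S\<close> and ends outside must cross the boundary. The
  lemma supplies the edges along which connected sets are enlarged.\<close>

lemma edge_leaving:
  assumes "S \<subseteq> V" "S \<noteq> {}" "S \<noteq> V"
  obtains a z where "a \<in> S" "z \<in> V - S" "(a, z) \<in> E"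
proof -
  obtain x y where xy: "x \<in> S" "y \<in> V - S" using assms by blast
  then have "(x, y) \<in> E\<^sup>*" using reach assms(1) by blast
  then have "y \<in> S \<or> (\<exists>a\<in>S. \<exists>z\<in>V - S. (a, z) \<in> E)"
  proof (induction rule: rtrancl_induct)
    case base
    then show ?case using xy by simp
  next
    case (step y z)
    then show ?case using E_subset by blast
  qed
  with xy that show thesis by blast
qed

end

section \<open>Sets grown along edges\<close>

text \<open>For symmetric \<open>E\<close> these are the finite nonempty sets that induce a
  connected subgraph. Rule induction plays the part of removing a leaf from a spanning tree.\<close>

inductive grown :: "('a \<times> 'a) set \<Rightarrow> 'a set \<Rightarrow> bool" for E where
  single: "grown E {x}"
| grow: "grown E K \<Longrightarrow> a \<in> K \<Longrightarrow> z \<notin> K \<Longrightarrow> (a, z) \<in> E \<Longrightarrow> grown E (insert z K)"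

lemma grown_finite: "grown E K \<Longrightarrow> finite K"
  by (induction rule: grown.induct) auto

lemma grown_nonempty: "grown E K \<Longrightarrow> K \<noteq> {}"
  by (induction rule: grown.induct) auto

lemma grown_card: "grown E K \<Longrightarrow> 0 < card K"
  by (simp add: grown_finite grown_nonempty card_gt_0_iff)

text \<open>Choosing one earlier neighbour for each index encodes a spanning tree rooted at
  \<open>c 0\<close>. The depth of a vertex in it never exceeds its index, whence
  \<open>growth_order_d_le\<close>.\<close>

definition growth_order :: "('a \<times> 'a) set \<Rightarrow> 'a set \<Rightarrow> (nat \<Rightarrow> 'a) \<Rightarrow> bool" where
  "growth_order E K c \<longleftrightarrow> bij_betw c {..<card K} K \<and>
     (\<forall>i. 0 < i \<longrightarrow> i < card K \<longrightarrow> (\<exists>j<i. (c j, c i) \<in> E))"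

text \<open>The start is free because distances are measured from arbitrary vertices. If
  \<open>x\<close> is the newest vertex \<open>z\<close>, it is put in front of an order that starts
  at its neighbour \<open>a\<close>; otherwise \<open>z\<close> is appended to an order that starts
  at \<open>x\<close>.\<close>

lemma growth_order_exists:
  assumes "sym E" "grown E K" "x \<in> K"
  shows "\<exists>c. growth_order E K c \<and> c 0 = x"
  using assms(2,3)
proof (induction arbitrary: x rule: grown.induct)
  case (single y)
  then show ?case by (intro exI[of _ "\<lambda>_. y"]) (auto simp: growth_order_def bij_betw_def lessThan_Suc)
next
  case (grow K a z)
  have fin: "finite K" and pos: "0 < card K" using grow.hyps grown_finite grown_card by auto
  have card: "card (insert z K) = Suc (card K)" using fin grow.hyps by simp
  show ?case
  proof (cases "x = z")
    case True
    obtain c where c: "growth_order E K c" "c 0 = a" using grow.IH[OF grow.hyps(2)] by blast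
    have bij: "bij_betw c {..<card K} K" using c by (simp add: growth_order_def)
    define c' where "c' = case_nat z c"
    have img: "c' ` {..<Suc (card K)} = insert z K"
      using bij by (auto simp: c'_def bij_betw_def lessThan_Suc_eq_insert_0 image_image)
    then have "bij_betw c' {..<Suc (card K)} (insert z K)"
      unfolding bij_betw_def using card by (simp add: eq_card_imp_inj_on)
    moreover have "\<exists>j<i. (c' j, c' i) \<in> E" if i: "0 < i" "i < Suc (card K)" for i
    proof -
      obtain i' where i': "i = Suc i'" "i' < card K" using i by (cases i) auto
      show ?thesis
      proof (cases "i' = 0")
        case True
        with i' c(2) grow.hyps(4) assms(1) show ?thesis
          by (intro exI[of _ 0]) (auto simp: c'_def dest: symD)
      next
        case False
        then obtain j where "j < i'" "(c j, c i') \<in> E"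
          using c(1) i' by (auto simp: growth_order_def)
        with i' show ?thesis by (intro exI[of _ "Suc j"]) (auto simp: c'_def)
      qed
    qed
    ultimately show ?thesis
      using True card by (intro exI[of _ c']) (auto simp: growth_order_def c'_def)
  next
    case False
    with grow.prems have "x \<in> K" by simp
    then obtain c where c: "growth_order E K c" "c 0 = x" using grow.IH by blast
    have bij: "bij_betw c {..<card K} K" using c by (simp add: growth_order_def)
    then obtain j where j: "j < card K" "c j = a"
      using grow.hyps(2) by (metis bij_betw_imp_surj_on imageE lessThan_iff)
    define c' where "c' = c(card K := z)"
    have eq: "c' i = c i" if "i < card K" for i using that by (simp add: c'_def)
    have "c' ` {..<Suc (card K)} = insert z K"
      using bij by (auto simp: c'_def bij_betw_def lessThan_Suc)
    then have "bij_betw c' {..<Suc (card K)} (insert z K)"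
      unfolding bij_betw_def using card by (simp add: eq_card_imp_inj_on)
    moreover have "\<exists>j<i. (c' j, c' i) \<in> E" if i: "0 < i" "i < Suc (card K)" for i
    proof (cases "i = card K")
      case True
      with j grow.hyps(4) show ?thesis by (intro exI[of _ j]) (auto simp: c'_def)
    next
      case False
      then have "i < card K" using i by simp
      then obtain l where "l < i" "(c l, c i) \<in> E" using c(1) i by (auto simp: growth_order_def)
      with \<open>i < card K\<close> show ?thesis by (intro exI[of _ l]) (simp add: eq)
    qed
    ultimately show ?thesis
      using card c(2) pos by (intro exI[of _ c']) (auto simp: growth_order_def eq)
  qed
qed

context connected_ugraph
begin

lemma growth_order_in: "growth_order E K c \<Longrightarrow> i < card K \<Longrightarrow> c i \<in> K"
  by (auto simp: growth_order_def bij_betw_def)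

lemma growth_order_d_le:
  assumes "growth_order E K c" "K \<subseteq> V" "i < card K"
  shows "d (c 0) (c i) \<le> i"
  using assms(3)
proof (induction i rule: less_induct)
  case (less i)
  show ?case
  proof (cases "i = 0")
    case False
    then obtain j where j: "j < i" "(c j, c i) \<in> E"
      using assms(1) less.prems by (auto simp: growth_order_def)
    have "c 0 \<in> V" using growth_order_in[OF assms(1), of 0] less.prems assms(2) by auto
    then have "d (c i) (c 0) \<le> Suc (d (c j) (c 0))" using j d_adj_step by blast
    moreover have "d (c 0) (c j) \<le> j" using less.IH[of j] j less.prems by simp
    ultimately show ?thesis using j d_commute by (metis Suc_leI le_trans not_less_eq_eq)
  qed simp
qed

lemma grown_d_less:
  assumes "grown E K" "K \<subseteq> V" "x \<in> K" "y \<in> K"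
  shows "d x y < card K"
proof -
  obtain c where c: "growth_order E K c" "c 0 = x"
    using growth_order_exists[OF sym_E assms(1,3)] by blast
  then obtain i where "i < card K" "c i = y"
    using assms(4) unfolding growth_order_def by (metis bij_betw_imp_surj_on imageE lessThan_iff)
  with growth_order_d_le[OF c(1) assms(2)] c(2) show ?thesis by fastforce
qed

lemma sum_growth_order: "growth_order E K c \<Longrightarrow> (\<Sum>w\<in>K. g w) = (\<Sum>i<card K. g (c i))"
  unfolding growth_order_def by (metis sum.reindex_bij_betw)

text \<open>Terms are compared along a growth order from \<open>x\<close>. The right-hand side is
  the value at an end vertex of a path with \<open>card K\<close> vertices.\<close>

lemma grown_transmission_le:
  fixes g :: "nat \<Rightarrow> real"
  assumes "grown E K" "K \<subseteq> V" "x \<in> K" "mono g"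
  shows "(\<Sum>w\<in>K. g (d x w)) \<le> (\<Sum>i<card K. g i)"
proof -
  obtain c where c: "growth_order E K c" "c 0 = x"
    using growth_order_exists[OF sym_E assms(1,3)] by blast
  have "(\<Sum>i<card K. g (d x (c i))) \<le> (\<Sum>i<card K. g i)"
    using growth_order_d_le[OF c(1) assms(2)] c(2) assms(4) by (intro sum_mono) (auto dest: monoD)
  then show ?thesis by (simp add: sum_growth_order[OF c(1)])
qed

text \<open>Each new vertex is at most one step further from the old ones than the vertex it was attached
  to.\<close>

lemma grown_pair_sum_le:
  fixes F :: "nat \<Rightarrow> real"
  assumes "grown E K" "K \<subseteq> V" "F 0 = 0" "mono (\<lambda>i. F (Suc i))"
  shows "(\<Sum>x\<in>K. \<Sum>y\<in>K. F (d x y)) \<le> (\<Sum>x<card K. \<Sum>y<card K. F (nat \<bar>int x - int y\<bar>))"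
  using assms(1,2)
proof (induction rule: grown.induct)
  case (single x)
  then show ?case using assms(3) by simp
next
  case (grow K a z)
  let ?k = "card K"
  have fin: "finite K" and KV: "K \<subseteq> V" "z \<in> V" using grow grown_finite by auto
  have "(\<Sum>w\<in>K. F (d z w)) \<le> (\<Sum>w\<in>K. F (Suc (d a w)))"
  proof (rule sum_mono)
    fix w assume w: "w \<in> K"
    \<comment> \<open>\<open>F 0\<close> may exceed \<open>F 1\<close>, so monotonicity is used only
      between positive arguments; this is why the distance is shifted down by one.\<close>
    then have "1 \<le> d z w" "d z w \<le> Suc (d a w)"
      using d_pos[of z w] d_adj_step[of a z w] grow.hyps KV by auto
    then show "F (d z w) \<le> F (Suc (d a w))"
      using monoD[OF assms(4), of "d z w - 1" "d a w"] by simp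
  qed
  also have "\<dots> \<le> (\<Sum>i<?k. F (Suc i))"
    by (rule grown_transmission_le[OF grow.hyps(1) KV(1) grow.hyps(2) assms(4)])
  \<comment> \<open>Reversing the index places the new vertex at position \<open>?k\<close> of the
    path.\<close>
  also have "\<dots> = (\<Sum>i<?k. F (nat \<bar>int ?k - int i\<bar>))"
    by (rule sum.reindex_bij_witness[where i="\<lambda>i. ?k - Suc i" and j="\<lambda>i. ?k - Suc i"])
      (auto intro!: arg_cong[of _ _ F])
  finally have new: "(\<Sum>w\<in>K. F (d z w)) \<le> (\<Sum>i<?k. F (nat \<bar>int ?k - int i\<bar>))" .
  have "(\<Sum>x\<in>insert z K. \<Sum>y\<in>insert z K. F (d x y))
      = (\<Sum>x\<in>K. \<Sum>y\<in>K. F (d x y)) + 2 * (\<Sum>w\<in>K. F (d z w))"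
    using fin grow.hyps(3) assms(3) by (simp add: sum.distrib d_commute[of _ z])
  also have "\<dots> \<le> (\<Sum>x<?k. \<Sum>y<?k. F (nat \<bar>int x - int y\<bar>))
      + 2 * (\<Sum>i<?k. F (nat \<bar>int ?k - int i\<bar>))"
    using grow.IH[OF KV(1)] new by simp
  also have "\<dots> = (\<Sum>x<Suc ?k. \<Sum>y<Suc ?k. F (nat \<bar>int x - int y\<bar>))"
    using assms(3) by (simp add: sum.distrib abs_minus_commute[of _ "int ?k"])
  finally show ?case using fin grow.hyps(3) by simp
qed

end

section \<open>Counting ordered pairs, and distance sums of vertices mapped into a connected
  set\<close>

lemma sum_of_bool_product:
  assumes "finite L" "A \<subseteq> L" "B \<subseteq> L"
  shows "(\<Sum>u\<in>L. \<Sum>v\<in>L. of_bool (u \<in> A \<and> v \<in> B)) = card A * card B"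
proof -
  have "(\<Sum>v\<in>L. of_bool (u \<in> A \<and> v \<in> B)) = of_bool (u \<in> A) * card B" for u
    using assms by (auto simp: Int_absorb1 Int_def[symmetric])
  then show ?thesis using assms by (simp add: sum_distrib_right[symmetric] Int_absorb1)
qed

lemma sum_of_bool_neq:
  assumes "finite L"
  shows "(\<Sum>u\<in>L. \<Sum>v\<in>L. of_bool (u \<noteq> v) :: real) = real (card L) * (real (card L) - 1)"
proof -
  have "(\<Sum>v\<in>L. of_bool (u \<noteq> v) :: real) = real (card L) - 1" if u: "u \<in> L" for u
  proof -
    have "L \<inter> {v. u \<noteq> v} = L - {u}" by auto
    moreover have "0 < card L" using u assms card_gt_0_iff by blast
    ultimately show ?thesis using u assms by (simp add: of_nat_diff Suc_le_eq)
  qed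
  then show ?thesis by simp
qed

text \<open>With \<open>b = l - a\<close> this is \<open>(a - b)\<^sup>2 \<ge> 0\<close>. The floor
  costs nothing because the product is an integer.\<close>

lemma mult_diff_le_sq_div4:
  fixes a l :: nat
  assumes "a \<le> l"
  shows "a * (l - a) \<le> l\<^sup>2 div 4"
proof -
  define b where "b = l - a"
  then have l: "l = a + b" using assms by simp
  have "(int a - int b)\<^sup>2 \<ge> 0" by simp
  then have "4 * (int a * int b) \<le> (int a + int b)\<^sup>2" by (simp add: power2_eq_square algebra_simps)
  then have "int (4 * (a * b)) \<le> int ((a + b)\<^sup>2)" by simp
  then have "4 * (a * b) \<le> (a + b)\<^sup>2" by (simp only: of_nat_le_iff)
  then show ?thesis using l by simp
qed

context connected_ugraph
begin

text \<open>Contracting the newest vertex \<open>z\<close> of \<open>K\<close> into its neighbour changes the distance sum only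
  through the pairs separated by the edge to \<open>z\<close>, of which there are at most \<open>\<lfloor>l\<^sup>2 / 4\<rfloor>\<close>.\<close>

lemma grown_map_distance_sum_le:
  assumes "grown E K" "K \<subseteq> V" "finite L" "s ` L \<subseteq> K"
  shows "(\<Sum>u\<in>L. \<Sum>v\<in>L. d (s u) (s v)) \<le> (card K - 1) * (2 * ((card L)\<^sup>2 div 4))"
  using assms(1,2,4)
proof (induction arbitrary: s rule: grown.induct)
  case (single x)
  then have "s u = x" if "u \<in> L" for u using that by blast
  then show ?case by simp
next
  case (grow K a z)
  have fin: "finite K" and KV: "K \<subseteq> V" "z \<in> V" and pos: "0 < card K"
    using grow grown_finite grown_card by auto
  define t where "t u = (if s u = z then a else s u)" for u
  define Z where "Z = {u \<in> L. s u = z}"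
  have tK: "t ` L \<subseteq> K" using grow.prems grow.hyps by (auto simp: t_def)
  have ZL: "Z \<subseteq> L" "finite Z" using assms(3) by (auto simp: Z_def)
  have step: "d (s u) (s v) \<le> d (t u) (t v)
      + (of_bool (u \<in> Z \<and> v \<in> L - Z) + of_bool (u \<in> L - Z \<and> v \<in> Z))"
    if "u \<in> L" "v \<in> L" for u v
  proof -
    have "s u \<in> V" "s v \<in> V" using that grow.prems by auto
    then show ?thesis
      using that d_adj_step[OF grow.hyps(4), of "s u"] d_adj_step[OF grow.hyps(4), of "s v"]
      by (auto simp: t_def Z_def d_commute)
  qed
  have "(\<Sum>u\<in>L. \<Sum>v\<in>L. d (s u) (s v))
      \<le> (\<Sum>u\<in>L. \<Sum>v\<in>L. d (t u) (t v) + (of_bool (u \<in> Z \<and> v \<in> L - Z) + of_bool (u \<in> L - Z \<and> v \<in> Z)))"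
    by (intro sum_mono step)
  also have "\<dots> = (\<Sum>u\<in>L. \<Sum>v\<in>L. d (t u) (t v)) + 2 * (card Z * card (L - Z))"
    unfolding sum.distrib by (subst (1 2) sum_of_bool_product) (use ZL assms(3) in auto)
  also have "card (L - Z) = card L - card Z" using ZL by (simp add: card_Diff_subset)
  also have "card Z * (card L - card Z) \<le> (card L)\<^sup>2 div 4"
    by (rule mult_diff_le_sq_div4) (use ZL assms(3) in \<open>auto intro: card_mono\<close>)
  also have "(\<Sum>u\<in>L. \<Sum>v\<in>L. d (t u) (t v)) \<le> (card K - 1) * (2 * ((card L)\<^sup>2 div 4))"
    by (rule grow.IH[OF KV(1) tK])
  finally have "(\<Sum>u\<in>L. \<Sum>v\<in>L. d (s u) (s v))
      \<le> (card K - 1) * (2 * ((card L)\<^sup>2 div 4)) + 2 * ((card L)\<^sup>2 div 4)" by simp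
  also have "\<dots> = (card (insert z K) - 1) * (2 * ((card L)\<^sup>2 div 4))"
    using pos fin grow.hyps(3) by (cases "card K") auto
  finally show ?case .
qed

end

text \<open>Equality with the floor leaves \<open>(a - b)\<^sup>2 < 4\<close>, so the two parts
  differ by at most one.\<close>

lemma balanced_if_product_max:
  fixes a b :: nat
  assumes "a * b = (a + b)\<^sup>2 div 4"
  shows "a = (a + b + 1) div 2 \<and> b = (a + b) div 2 \<or> b = (a + b + 1) div 2 \<and> a = (a + b) div 2"
proof -
  have "(a + b)\<^sup>2 < 4 * (a * b) + 4" using assms by linarith
  then have "int ((a + b)\<^sup>2) < int (4 * (a * b) + 4)" by (simp only: of_nat_less_iff)
  then have "(int a - int b)\<^sup>2 < 2\<^sup>2" by (simp add: power2_eq_square algebra_simps)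
  then have "\<bar>int a - int b\<bar> < 2" using power2_less_imp_less[of "\<bar>int a - int b\<bar>" 2] by simp
  then have "a = b \<or> a = Suc b \<or> b = Suc a" by linarith
  then show ?thesis by auto
qed

section \<open>A small connected set containing a vertex cover\<close>

context connected_ugraph
begin

text \<open>As long as the set is not all of \<open>V\<close>, some edge leaves it and its outer end
  can be added. This pads a connected cover to an exact size.\<close>

lemma grown_extend:
  assumes "grown E K" "K \<subseteq> V" "card K \<le> j" "j \<le> card V"
  shows "\<exists>K'. grown E K' \<and> K \<subseteq> K' \<and> K' \<subseteq> V \<and> card K' = j"
  using assms(3,4)
proof (induction j rule: dec_induct)
  case base
  then show ?case using assms by blast
next
  case (step j)
  then obtain K' where K': "grown E K'" "K \<subseteq> K'" "K' \<subseteq> V" "card K' = j" by auto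
  with step.prems have "K' \<noteq> V" by auto
  then obtain a z where "a \<in> K'" "z \<in> V - K'" "(a, z) \<in> E"
    using edge_leaving K' grown_nonempty by metis
  then show ?case using K' grown_finite[OF K'(1)] grown.grow[OF K'(1), of a z]
    by (intro exI[of _ "insert z K'"]) auto
qed

text \<open>Growing from one cover vertex, the next one is reached after at most one vertex outside the
  cover.\<close>

lemma cover_in_grown:
  assumes indep: "\<And>u v. u \<in> I \<Longrightarrow> v \<in> I \<Longrightarrow> (u, v) \<notin> E" and ne: "V - I \<noteq> {}"
  shows "\<exists>K. grown E K \<and> V - I \<subseteq> K \<and> K \<subseteq> V \<and> card K + 1 \<le> 2 * card (V - I)"
proof -
  define C where "C = V - I"
  \<comment> \<open>More than half of \<open>K\<close> lies in the cover \<open>C\<close>. The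
    inequality survives adding a cover vertex, alone or together with one vertex outside the
    cover.\<close>
  define P where "P K \<longleftrightarrow> grown E K \<and> K \<subseteq> V \<and> card K + 1 \<le> 2 * card (K \<inter> C)" for K
  obtain x where x: "x \<in> C" using ne by (auto simp: C_def)
  then have "P {x}" using grown.single by (auto simp: P_def C_def)
  moreover have "\<forall>K. P K \<longrightarrow> card K < Suc (card V)"
    using finite_V by (auto simp: P_def less_Suc_eq_le intro: card_mono)
  ultimately obtain K where K: "P K" and max: "\<And>K'. P K' \<Longrightarrow> card K' \<le> card K"
    using ex_has_greatest_nat[of P "{x}" card "Suc (card V)"] by metis
  have g: "grown E K" and KV: "K \<subseteq> V" and cK: "card K + 1 \<le> 2 * card (K \<inter> C)"
    using K by (auto simp: P_def)
  have fin: "finite K" and ne: "K \<noteq> {}" using g grown_finite grown_nonempty by auto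
  \<comment> \<open>Such a vertex \<open>z\<close> could be added to \<open>K\<close>, against
    maximality.\<close>
  have noC: "(a, z) \<notin> E" if "a \<in> K" "z \<in> C - K" for a z
  proof
    assume "(a, z) \<in> E"
    then have "grown E (insert z K)" using g that grown.grow by (metis DiffD2)
    then have "P (insert z K)" using that KV cK fin by (auto simp: P_def C_def Int_insert_left)
    from max[OF this] that fin show False by simp
  qed
  have "C \<subseteq> K"
  proof (rule ccontr)
    assume nsub: "\<not> C \<subseteq> K"
    \<comment> \<open>\<open>S\<close> is the closed neighbourhood of \<open>K\<close>; by
      \<open>noC\<close> it misses the cover vertices outside \<open>K\<close>. An edge
      \<open>b z\<close> leaving it has \<open>b\<close> in \<open>I\<close>, hence \<open>z\<close>
      in the cover by independence, and adding both \<open>b\<close> and \<open>z\<close>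
      contradicts maximality.\<close>
    define S where "S = K \<union> {b \<in> V. \<exists>a\<in>K. (a, b) \<in> E}"
    have "S \<noteq> V" using nsub noC by (auto simp: S_def C_def)
    moreover have "S \<subseteq> V" "S \<noteq> {}" using KV ne by (auto simp: S_def)
    ultimately obtain b z where bz: "b \<in> S" "z \<in> V - S" "(b, z) \<in> E" using edge_leaving by metis
    then have bK: "b \<notin> K" by (auto simp: S_def)
    then obtain a where a: "a \<in> K" "(a, b) \<in> E" "b \<in> V" using bz by (auto simp: S_def)
    then have "b \<in> I" using noC bK by (auto simp: C_def)
    then have z: "z \<in> C" "z \<notin> K" "z \<noteq> b" using indep bz by (auto simp: C_def S_def)
    have "grown E (insert b K)" using g a bK grown.grow by metis
    then have "grown E (insert z (insert b K))" using bz(3) z grown.grow by (metis insert_iff)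
    then have "P (insert z (insert b K))"
      using KV cK fin z bK a \<open>b \<in> I\<close> by (auto simp: P_def C_def Int_insert_left)
    from max[OF this] fin z bK show False by simp
  qed
  then have "K \<inter> C = C" by blast
  with g KV cK \<open>C \<subseteq> K\<close> show ?thesis unfolding C_def by metis
qed

end

section \<open>Core and pendent vertices\<close>

text \<open>
  Twice the value for the tree with a path of \<open>k\<close> vertices and \<open>l\<close> balanced pendent vertices: pairs on
  the path, pairs of a pendent and a path vertex, and pairs of pendent vertices, of which
  \<open>\<lfloor>l\<^sup>2 / 4\<rfloor>\<close> are at distance \<open>k + 1\<close> and the others at distance \<open>2\<close>.
\<close>

definition extremal_sum :: "(nat \<Rightarrow> real) \<Rightarrow> nat \<Rightarrow> nat \<Rightarrow> real" where
  "extremal_sum F k l = (\<Sum>x<k. \<Sum>y<k. F (nat \<bar>int x - int y\<bar>)) + 2 * (l * (\<Sum>i<k. F (Suc i)))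
     + (real l * (real l - 1) * F 2 + (F (Suc k) - F 2) * real (2 * (l\<^sup>2 div 4)))"

text \<open>\<open>F\<close> is \<open>f\<close> at the natural numbers. \<open>F_chord\<close> is
  the form of convexity used: on \<open>[2, 2 + j]\<close> the function lies below its chord.
  \<open>F_strict\<close> starts at 1 because \<open>f\<close> may jump upwards at 0.\<close>

locale core_decomposition = connected_ugraph +
  fixes K :: "'a set" and s :: "'a \<Rightarrow> 'a" and F :: "nat \<Rightarrow> real"
  assumes grown_K: "grown E K" and K_subset: "K \<subseteq> V"
    and attach: "\<And>u. u \<in> V - K \<Longrightarrow> s u \<in> K \<and> (s u, u) \<in> E"
    and F_0: "F 0 = 0" and F_strict: "\<And>i j. 0 < i \<Longrightarrow> i < j \<Longrightarrow> F i < F j"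
    and F_chord: "\<And>e j. e \<le> j \<Longrightarrow> F (2 + e) \<le> F 2 + (F (2 + j) - F 2) / real j * real e"
begin

abbreviation "L \<equiv> V - K"
abbreviation "k \<equiv> card K"
abbreviation "l \<equiv> card L"

text \<open>For \<open>k = 1\<close> the slope is \<open>0\<close>, by division by zero.\<close>

definition slope :: real where
  "slope = (F (Suc k) - F 2) / real (k - 1)"

lemma finite_L: "finite L" and k_pos: "0 < k"
  using finite_V grown_card[OF grown_K] by auto

lemma F_mono: "0 < i \<Longrightarrow> i \<le> j \<Longrightarrow> F i \<le> F j"
  using F_strict[of i j] by (cases "i = j") auto

lemma F_inj: "0 < i \<Longrightarrow> 0 < j \<Longrightarrow> F i = F j \<Longrightarrow> i = j"
  using F_strict[of i j] F_strict[of j i] by (metis less_irrefl nat_neq_iff)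

lemma F_Suc_mono: "mono (\<lambda>i. F (Suc i))"
  by (auto intro!: monoI F_mono)

text \<open>For \<open>k = 1\<close> both sides are 0, because then
  \<open>Suc k = 2\<close>.\<close>

lemma slope_mult: "slope * real (k - 1) = F (Suc k) - F 2"
  using k_pos by (cases "k = 1") (auto simp: slope_def numeral_2_eq_2)

lemma slope_pos: "2 \<le> k \<Longrightarrow> 0 < slope"
  using F_strict[of 2 "Suc k"] by (simp add: slope_def)

lemma slope_nonneg: "0 \<le> slope"
  using slope_pos k_pos by (cases "k = 1") (auto simp: slope_def)

lemma F_le_chord: "e \<le> k - 1 \<Longrightarrow> F (2 + e) \<le> F 2 + slope * real e"
  using F_chord[of e "k - 1"] k_pos by (simp add: slope_def numeral_2_eq_2)

lemma in_L: "u \<in> L \<Longrightarrow> u \<in> V \<and> s u \<in> K \<and> s u \<in> V \<and> (s u, u) \<in> E"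
  using attach K_subset by auto

lemma attach_d_le: "u \<in> L \<Longrightarrow> v \<in> L \<Longrightarrow> d (s u) (s v) \<le> k - 1"
  using grown_d_less[OF grown_K K_subset, of "s u" "s v"] in_L[of u] in_L[of v] by auto

lemma pair_sum_split:
  "(\<Sum>x\<in>V. \<Sum>y\<in>V. F (d x y)) = (\<Sum>x\<in>K. \<Sum>y\<in>K. F (d x y))
     + 2 * (\<Sum>u\<in>L. \<Sum>w\<in>K. F (d u w)) + (\<Sum>u\<in>L. \<Sum>v\<in>L. F (d u v))"
proof -
  have split: "(\<Sum>x\<in>V. h x) = (\<Sum>x\<in>K. h x) + (\<Sum>x\<in>L. h x)" for h :: "'a \<Rightarrow> real"
    using sum.subset_diff[OF K_subset finite_V, of h] by simp
  have "(\<Sum>x\<in>K. \<Sum>y\<in>L. F (d x y)) = (\<Sum>u\<in>L. \<Sum>w\<in>K. F (d u w))"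
    by (subst sum.swap) (simp add: d_commute)
  then show ?thesis by (simp add: split sum.distrib)
qed

lemma leaf_core_step:
  assumes "u \<in> L" "w \<in> K"
  shows "1 \<le> d u w" "d u w \<le> Suc (d (s u) w)"
  using assms in_L[of u] K_subset d_adj_step[of "s u" u w] d_pos[of u w] by auto

text \<open>Walking to \<open>s u\<close> first costs one step, so the transmission bound at
  \<open>s u\<close> applies to the shifted function.\<close>

lemma leaf_core_sum_le:
  assumes "u \<in> L"
  shows "(\<Sum>w\<in>K. F (d u w)) \<le> (\<Sum>i<k. F (Suc i))"
proof -
  have "(\<Sum>w\<in>K. F (d u w)) \<le> (\<Sum>w\<in>K. F (Suc (d (s u) w)))"
    using leaf_core_step[OF assms] by (intro sum_mono F_mono) (auto simp: Suc_le_eq)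
  also have "\<dots> \<le> (\<Sum>i<k. F (Suc i))"
    using grown_transmission_le[OF grown_K K_subset _ F_Suc_mono] in_L[OF assms] by blast
  finally show ?thesis .
qed

text \<open>The walk from \<open>u\<close> through \<open>s u\<close> and \<open>s v\<close> to
  \<open>v\<close> gives \<open>d u v \<le> 2 + d (s u) (s v)\<close>. The chord then makes the
  bound linear in the distance between the attachment vertices, so that only a sum of distances is
  left.\<close>

lemma leaf_leaf_sum_le:
  "(\<Sum>u\<in>L. \<Sum>v\<in>L. F (d u v)) \<le> real l * (real l - 1) * F 2
     + slope * real (\<Sum>u\<in>L. \<Sum>v\<in>L. d (s u) (s v))"
proof -
  have "F (d u v) \<le> F 2 * of_bool (u \<noteq> v) + slope * real (d (s u) (s v))"
    if uv: "u \<in> L" "v \<in> L" for u v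
  proof (cases "u = v")
    case True
    then show ?thesis using F_0 by simp
  next
    case False
    have "d u v \<le> Suc (d (s u) v)" "d v (s u) \<le> Suc (d (s v) (s u))"
      using d_adj_step in_L uv by blast+
    then have "d u v \<le> 2 + d (s u) (s v)" by (simp add: d_commute)
    moreover have "0 < d u v" using False uv d_pos[of u v] by simp
    ultimately have "F (d u v) \<le> F (2 + d (s u) (s v))" by (rule F_mono[rotated])
    also have "\<dots> \<le> F 2 + slope * real (d (s u) (s v))"
      by (rule F_le_chord[OF attach_d_le[OF uv]])
    finally show ?thesis using False by simp
  qed
  then have "(\<Sum>u\<in>L. \<Sum>v\<in>L. F (d u v))
      \<le> (\<Sum>u\<in>L. \<Sum>v\<in>L. F 2 * of_bool (u \<noteq> v) + slope * real (d (s u) (s v)))"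
    by (intro sum_mono)
  also have "\<dots> = F 2 * (\<Sum>u\<in>L. \<Sum>v\<in>L. of_bool (u \<noteq> v))
      + slope * real (\<Sum>u\<in>L. \<Sum>v\<in>L. d (s u) (s v))"
    by (simp add: sum.distrib sum_distrib_left)
  also have "(\<Sum>u\<in>L. \<Sum>v\<in>L. of_bool (u \<noteq> v) :: real) = real l * (real l - 1)"
    by (rule sum_of_bool_neq[OF finite_L])
  finally show ?thesis by (simp add: mult_ac)
qed

text \<open>The factor \<open>k - 1\<close>, the number of edges of a spanning tree of
  \<open>K\<close>, cancels against the denominator of \<open>slope\<close>.\<close>

lemma attach_sum_le:
  "slope * real (\<Sum>u\<in>L. \<Sum>v\<in>L. d (s u) (s v)) \<le> (F (Suc k) - F 2) * real (2 * (l\<^sup>2 div 4))"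
proof -
  have "(\<Sum>u\<in>L. \<Sum>v\<in>L. d (s u) (s v)) \<le> (k - 1) * (2 * (l\<^sup>2 div 4))"
    by (rule grown_map_distance_sum_le[OF grown_K K_subset finite_L]) (use in_L in auto)
  then have "real (\<Sum>u\<in>L. \<Sum>v\<in>L. d (s u) (s v)) \<le> real (k - 1) * real (2 * (l\<^sup>2 div 4))"
    by (simp only: of_nat_le_iff of_nat_mult[symmetric])
  from mult_left_mono[OF this slope_nonneg] show ?thesis
    by (simp only: mult.assoc[symmetric] slope_mult)
qed

lemma core_core_sum_le:
  "(\<Sum>x\<in>K. \<Sum>y\<in>K. F (d x y)) \<le> (\<Sum>x<k. \<Sum>y<k. F (nat \<bar>int x - int y\<bar>))"
  by (rule grown_pair_sum_le[OF grown_K K_subset F_0 F_Suc_mono])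

lemma leaf_core_sum_total_le: "(\<Sum>u\<in>L. \<Sum>w\<in>K. F (d u w)) \<le> real l * (\<Sum>i<k. F (Suc i))"
  using sum_bounded_above[of L "\<lambda>u. \<Sum>w\<in>K. F (d u w)"] leaf_core_sum_le by auto

lemma pair_sum_le_extremal: "(\<Sum>x\<in>V. \<Sum>y\<in>V. F (d x y)) \<le> extremal_sum F k l"
  unfolding pair_sum_split extremal_sum_def
  using core_core_sum_le leaf_core_sum_total_le leaf_leaf_sum_le attach_sum_le by linarith

section \<open>The case of equality\<close>

context
  assumes extremal: "(\<Sum>x\<in>V. \<Sum>y\<in>V. F (d x y)) = extremal_sum F k l"
begin

text \<open>Equality of the totals makes each of the added estimates tight, and a tight sum of
  bounded terms is tight in every term.\<close>

lemma leaf_core_sum_eq: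
  assumes "u \<in> L"
  shows "(\<Sum>w\<in>K. F (d u w)) = (\<Sum>i<k. F (Suc i))"
proof -
  have "(\<Sum>u\<in>L. \<Sum>w\<in>K. F (d u w)) = (\<Sum>u\<in>L. \<Sum>i<k. F (Suc i))"
    using extremal core_core_sum_le leaf_core_sum_total_le leaf_leaf_sum_le attach_sum_le
    unfolding pair_sum_split extremal_sum_def by simp
  from sum_mono_inv[OF this leaf_core_sum_le assms finite_L] show ?thesis .
qed

text \<open>\<open>slope\<close> can be cancelled only when it is positive, hence the assumption on
  \<open>k\<close>.\<close>

lemma attach_sum_eq:
  assumes "2 \<le> k"
  shows "(\<Sum>u\<in>L. \<Sum>v\<in>L. d (s u) (s v)) = (k - 1) * (2 * (l\<^sup>2 div 4))"
proof -
  have "slope * real (\<Sum>u\<in>L. \<Sum>v\<in>L. d (s u) (s v)) = (F (Suc k) - F 2) * real (2 * (l\<^sup>2 div 4))"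
    using extremal core_core_sum_le leaf_core_sum_total_le leaf_leaf_sum_le attach_sum_le
    unfolding pair_sum_split extremal_sum_def by linarith
  also have "\<dots> = slope * real ((k - 1) * (2 * (l\<^sup>2 div 4)))"
    unfolding slope_mult[symmetric] by (simp only: of_nat_mult mult.assoc)
  finally show ?thesis using slope_pos[OF assms] by (simp only: mult_cancel_left of_nat_eq_iff) simp
qed

text \<open>In a growth order from \<open>s u\<close>, termwise equality and injectivity of
  \<open>F\<close> at positive arguments make every distance bound exact. Consecutive vertices must
  then be adjacent, so the order traces a path.\<close>

lemma leaf_order:
  assumes u: "u \<in> L"
  obtains c where "bij_betw c {..<k} K" "c 0 = s u"
    and "\<And>i. i < k \<Longrightarrow> d u (c i) = Suc i" "\<And>i. i < k \<Longrightarrow> d (s u) (c i) = i"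
    and "\<And>i. Suc i < k \<Longrightarrow> (c i, c (Suc i)) \<in> E"
proof -
  obtain c where c: "growth_order E K c" "c 0 = s u"
    using growth_order_exists[OF sym_E grown_K] in_L[OF u] by blast
  have cK: "c i \<in> K" if "i < k" for i using growth_order_in[OF c(1) that] .
  have ds: "d (s u) (c i) \<le> i" if "i < k" for i
    using growth_order_d_le[OF c(1) K_subset that] c(2) by simp
  have le: "d u (c i) \<le> Suc i" "1 \<le> d u (c i)" if "i < k" for i
    using leaf_core_step[OF u cK[OF that]] ds[OF that] by auto
  have sum: "(\<Sum>i<k. F (d u (c i))) = (\<Sum>i<k. F (Suc i))"
    using leaf_core_sum_eq[OF u] sum_growth_order[OF c(1), of "\<lambda>w. F (d u w)"] by simp
  have du: "d u (c i) = Suc i" if i: "i < k" for i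
  proof -
    have "F (d u (c i)) = F (Suc i)"
    proof (rule sum_mono_inv[OF sum])
      show "F (d u (c j)) \<le> F (Suc j)" if "j \<in> {..<k}" for j
        using that le[of j] by (intro F_mono) auto
    qed (use i in auto)
    then show ?thesis using F_inj le(2)[OF i] by fastforce
  qed
  have dsu: "d (s u) (c i) = i" if "i < k" for i
    using du[OF that] ds[OF that] leaf_core_step(2)[OF u cK[OF that]] by simp
  have adj: "(c i, c (Suc i)) \<in> E" if i: "Suc i < k" for i
  proof -
    obtain j where j: "j < Suc i" "(c j, c (Suc i)) \<in> E"
      using c(1) i unfolding growth_order_def by blast
    have "d (c (Suc i)) (s u) \<le> Suc (d (c j) (s u))"
      using d_adj_step[OF j(2)] in_L[OF u] by blast
    \<comment> \<open>The distance from \<open>s u\<close> grows by at most one along an edge, so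
      the earlier neighbour of \<open>c (Suc i)\<close> can only be \<open>c i\<close>.\<close>
    then have "j = i" using dsu[of j] dsu[of "Suc i"] i j(1) by (simp add: d_commute)
    with j show ?thesis by simp
  qed
  show thesis
    by (rule that[OF _ c(2) du dsu adj]) (use c(1) in \<open>auto simp: growth_order_def\<close>)
qed

lemma leaf_core_adj:
  assumes u: "u \<in> L" and w: "w \<in> K"
  shows "(u, w) \<in> E \<longleftrightarrow> w = s u"
proof
  assume uw: "(u, w) \<in> E"
  obtain c where c: "bij_betw c {..<k} K" "c 0 = s u" "\<And>i. i < k \<Longrightarrow> d u (c i) = Suc i"
    using leaf_order[OF u] by metis
  obtain i where i: "i < k" "w = c i"
    using c(1) w by (metis bij_betw_imp_surj_on imageE lessThan_iff)
  have "d u w = 1" using uw d_eq_1[of u w] u w K_subset by blast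
  then show "w = s u" using c i by auto
next
  assume "w = s u"
  then show "(u, w) \<in> E" using in_L[OF u] E_commute by blast
qed

lemma consecutive_d_le:
  assumes c: "\<And>i. i < k \<Longrightarrow> c i \<in> K" "\<And>i. Suc i < k \<Longrightarrow> (c i, c (Suc i)) \<in> E"
    and "i \<le> j" "j < k"
  shows "d (c i) (c j) \<le> j - i"
  using assms(3,4)
proof (induction j rule: dec_induct)
  case (step j)
  have "i < k" using step.hyps step.prems by simp
  then have "c i \<in> V" using c(1) K_subset by blast
  then have "d (c (Suc j)) (c i) \<le> Suc (d (c j) (c i))" by (rule d_adj_step[OF c(2)[OF step.prems]])
  moreover have "d (c i) (c j) \<le> j - i" using step.IH step.prems by simp
  ultimately show ?case using step.hyps d_commute[of "c i"] by (simp add: Suc_diff_le)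
qed simp

text \<open>The order of one leaf already traces \<open>K\<close>; its exact distances from
  \<open>c 0\<close> exclude chords.\<close>

lemma core_path:
  assumes "L \<noteq> {}"
  obtains c where "bij_betw c {..<k} K"
    and "\<And>i j. i < k \<Longrightarrow> j < k \<Longrightarrow> (c i, c j) \<in> E \<longleftrightarrow> i = Suc j \<or> j = Suc i"
    and "\<And>u. u \<in> L \<Longrightarrow> s u = c 0 \<or> s u = c (k - 1)"
    and "d (c 0) (c (k - 1)) = k - 1"
proof -
  obtain u0 where u0: "u0 \<in> L" using assms by blast
  obtain c where bij: "bij_betw c {..<k} K" and c0: "c 0 = s u0"
    and dc: "\<And>i. i < k \<Longrightarrow> d (s u0) (c i) = i"
    and adj: "\<And>i. Suc i < k \<Longrightarrow> (c i, c (Suc i)) \<in> E"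
    using leaf_order[OF u0] by metis
  have cK: "c i \<in> K" if "i < k" for i using bij that by (auto simp: bij_betw_def)
  have "(c i, c j) \<in> E \<longleftrightarrow> i = Suc j \<or> j = Suc i" if ij: "i < k" "j < k" for i j
  proof
    assume e: "(c i, c j) \<in> E"
    have "s u0 \<in> V" using in_L[OF u0] by blast
    then have "j \<le> Suc i" "i \<le> Suc j"
      using d_adj_step[OF e, of "s u0"] d_adj_step[of "c j" "c i" "s u0"] e E_commute dc ij
      by (auto simp: d_commute)
    moreover have "i \<noteq> j" using e no_loop by auto
    ultimately show "i = Suc j \<or> j = Suc i" by linarith
  next
    assume "i = Suc j \<or> j = Suc i"
    then show "(c i, c j) \<in> E" using adj ij E_commute by blast
  qed
  moreover have dle: "d (c i) (c j) \<le> j - i" if "i \<le> j" "j < k" for i j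
    using consecutive_d_le[of c i j] cK adj that by blast
  moreover have "s u = c 0 \<or> s u = c (k - 1)" if u: "u \<in> L" for u
  proof -
    obtain e where e: "bij_betw e {..<k} K" "\<And>i. i < k \<Longrightarrow> d (s u) (e i) = i"
      using leaf_order[OF u] by metis
    have ek: "d (s u) (e (k - 1)) = k - 1" using e(2) k_pos by simp
    have "e (k - 1) \<in> K" using e(1) k_pos by (auto simp: bij_betw_def)
    then obtain j where j: "j < k" "e (k - 1) = c j"
      using bij by (metis bij_betw_imp_surj_on imageE lessThan_iff)
    obtain i where i: "i < k" "s u = c i"
      using bij in_L[OF u] by (metis bij_betw_imp_surj_on imageE lessThan_iff)
    \<comment> \<open>By its own order, \<open>s u\<close> has a vertex of \<open>K\<close> at
      distance \<open>k - 1\<close>. Index differences along \<open>c\<close> bound distances from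
      above, so \<open>s u\<close> is an end of the path.\<close>
    have "k - 1 \<le> j - i \<or> k - 1 \<le> i - j"
      using dle[of i j] dle[of j i] ek i j by (cases "i \<le> j") (auto simp: d_commute)
    then have "i = 0 \<or> i = k - 1" using i j by linarith
    with i show ?thesis by auto
  qed
  moreover have "d (c 0) (c (k - 1)) = k - 1" using dc[of "k - 1"] c0 k_pos by simp
  ultimately show thesis using that bij by blast
qed

text \<open>For \<open>k \<ge> 2\<close> the attachment distances sum to \<open>2 (k - 1)\<close>
  times the product of the sizes of the two leaf classes. Equality makes this product maximal and
  hence the classes balanced.\<close>

lemma double_broom:
  assumes "L \<noteq> {}"
  obtains c L1 L2 where "bij_betw c {..<k} K"
    and "\<And>i j. i < k \<Longrightarrow> j < k \<Longrightarrow> (c i, c j) \<in> E \<longleftrightarrow> i = Suc j \<or> j = Suc i"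
    and "L = L1 \<union> L2" "L1 \<inter> L2 = {}" "card L1 = (l + 1) div 2" "card L2 = l div 2"
    and "\<And>u i. u \<in> L1 \<Longrightarrow> i < k \<Longrightarrow> (u, c i) \<in> E \<longleftrightarrow> i = 0"
    and "\<And>u i. u \<in> L2 \<Longrightarrow> i < k \<Longrightarrow> (u, c i) \<in> E \<longleftrightarrow> i = k - 1"
proof -
  obtain c where bij: "bij_betw c {..<k} K"
    and adj: "\<And>i j. i < k \<Longrightarrow> j < k \<Longrightarrow> (c i, c j) \<in> E \<longleftrightarrow> i = Suc j \<or> j = Suc i"
    and ends: "\<And>u. u \<in> L \<Longrightarrow> s u = c 0 \<or> s u = c (k - 1)"
    and dk: "d (c 0) (c (k - 1)) = k - 1"
    by (rule core_path[OF assms]) blast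
  have inj: "c i = c j \<longleftrightarrow> i = j" if "i < k" "j < k" for i j
    using bij that by (auto simp: bij_betw_def inj_on_def)
  have uc: "(u, c i) \<in> E \<longleftrightarrow> c i = s u" if "u \<in> L" "i < k" for u i
    using leaf_core_adj that bij by (auto simp: bij_betw_def)
  show thesis
  proof (cases "k = 1")
    \<comment> \<open>Both ends are the same vertex here, so any split of \<open>L\<close> into the
      right sizes works.\<close>
    case True
    have "(l + 1) div 2 \<le> l" by (cases l) auto
    then obtain L1 where L1: "L1 \<subseteq> L" "card L1 = (l + 1) div 2"
      using obtain_subset_with_card_n by metis
    have "card (L - L1) = l - card L1" using L1 finite_L by (simp add: card_Diff_subset finite_subset)
    then have "card (L - L1) = l div 2" using L1(2) by linarith
    then show thesis
      using L1 True uc ends by (intro that[OF bij adj, of L1 "L - L1"]) auto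
  next
    case False
    then have k2: "2 \<le> k" using k_pos by simp
    define A where "A = {u \<in> L. s u = c 0}"
    define B where "B = {u \<in> L. s u = c (k - 1)}"
    have AB: "A \<union> B = L" using ends by (auto simp: A_def B_def)
    have ne: "c 0 \<noteq> c (k - 1)" using inj[of 0 "k - 1"] k2 by simp
    then have disj: "A \<inter> B = {}" by (auto simp: A_def B_def)
    have sub: "A \<subseteq> L" "B \<subseteq> L" "finite A" "finite B" using finite_V by (auto simp: A_def B_def)
    have card: "card A + card B = l" using card_Un_disjoint[OF sub(3,4) disj] unfolding AB by simp
    have deq: "d (s u) (s v) = (k - 1) * (of_bool (u \<in> A \<and> v \<in> B) + of_bool (u \<in> B \<and> v \<in> A))"
      if "u \<in> L" "v \<in> L" for u v
    proof -
      have mem: "x \<in> A \<longleftrightarrow> s x = c 0" "x \<in> B \<longleftrightarrow> s x = c (k - 1)" if "x \<in> L" for x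
        using that by (auto simp: A_def B_def)
      have "d (c (k - 1)) (c 0) = k - 1" using dk d_commute by metis
      with ends[OF that(1)] ends[OF that(2)] show ?thesis
        unfolding mem[OF that(1)] mem[OF that(2)] using ne dk by (elim disjE) simp_all
    qed
    have "(\<Sum>u\<in>L. \<Sum>v\<in>L. d (s u) (s v))
        = (\<Sum>u\<in>L. \<Sum>v\<in>L. (k - 1) * (of_bool (u \<in> A \<and> v \<in> B) + of_bool (u \<in> B \<and> v \<in> A)))"
      by (rule sum.cong[OF refl], rule sum.cong[OF refl], rule deq)
    also have "\<dots> = (k - 1) * ((\<Sum>u\<in>L. \<Sum>v\<in>L. of_bool (u \<in> A \<and> v \<in> B))
        + (\<Sum>u\<in>L. \<Sum>v\<in>L. of_bool (u \<in> B \<and> v \<in> A)))"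
      by (simp only: sum_distrib_left sum.distrib distrib_left)
    also have "\<dots> = (k - 1) * (2 * (card A * card B))"
      unfolding sum_of_bool_product[OF finite_L sub(1,2)] sum_of_bool_product[OF finite_L sub(2,1)]
      by (simp only: mult_2 mult.commute)
    finally have "(k - 1) * (2 * (card A * card B)) = (k - 1) * (2 * (l\<^sup>2 div 4))"
      unfolding attach_sum_eq[OF k2] by (rule sym)
    then have "card A * card B = (card A + card B)\<^sup>2 div 4" unfolding card using k2 by simp
    from balanced_if_product_max[OF this] consider
      "card A = (l + 1) div 2" "card B = l div 2" | "card B = (l + 1) div 2" "card A = l div 2"
      unfolding card by blast
    then show thesis
    proof cases
      case 1
      show thesis
      proof (rule that[OF bij adj AB[symmetric] disj 1])
        show "(u, c i) \<in> E \<longleftrightarrow> i = 0" if "u \<in> A" "i < k" for u i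
          using that uc[of u i] inj[of i 0] k_pos by (auto simp: A_def)
        show "(u, c i) \<in> E \<longleftrightarrow> i = k - 1" if "u \<in> B" "i < k" for u i
          using that uc[of u i] inj[of i "k - 1"] k_pos by (auto simp: B_def)
      qed
    next
      case 2
      \<comment> \<open>The larger class sits at the far end, so the path is reversed to bring it to
        index 0.\<close>
      have bij': "bij_betw (\<lambda>i. c (k - 1 - i)) {..<k} K"
      proof -
        have "bij_betw (\<lambda>i. k - 1 - i) {..<k} {..<k}"
          by (rule bij_betw_byWitness[where f'="\<lambda>i. k - 1 - i"]) auto
        from bij_betw_trans[OF this bij] show ?thesis by (simp add: o_def)
      qed
      show thesis
      proof (rule that[OF bij' _ _ _ 2])
        fix i assume i: "i < k"
        then have i': "k - 1 - i < k" by simp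
        show "(c (k - 1 - i), c (k - 1 - j)) \<in> E \<longleftrightarrow> i = Suc j \<or> j = Suc i" if j: "j < k" for j
        proof -
          have "k - 1 - j < k" using j by simp
          moreover have "k - 1 - i = Suc (k - 1 - j) \<or> k - 1 - j = Suc (k - 1 - i)
              \<longleftrightarrow> i = Suc j \<or> j = Suc i" using i j by arith
          ultimately show ?thesis using adj[OF i'] by blast
        qed
        show "(u, c (k - 1 - i)) \<in> E \<longleftrightarrow> i = 0" if u: "u \<in> B" for u
        proof -
          have "k - 1 - i = k - 1 \<longleftrightarrow> i = 0" using i by arith
          then show ?thesis using u uc[OF _ i', of u] inj[OF i', of "k - 1"] k_pos by (simp add: B_def)
        qed
        show "(u, c (k - 1 - i)) \<in> E \<longleftrightarrow> i = k - 1" if u: "u \<in> A" for u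
        proof -
          have "k - 1 - i = 0 \<longleftrightarrow> i = k - 1" using i by arith
          then show ?thesis using u uc[OF _ i', of u] inj[OF i' k_pos] by (simp only: A_def mem_Collect_eq)
        qed
      next
        show "L = B \<union> A" "B \<inter> A = {}" using AB disj by auto
      qed
    qed
  qed
qed

end

end

section \<open>The distance sum of a graph\<close>

lemma awalk_length_iff_relpow:
  assumes "pair_graph G" "u \<in> pverts G"
  shows "(\<exists>p. pre_digraph.awalk (with_proj G) u p v \<and> length p = n) \<longleftrightarrow> (u, v) \<in> parcs G ^^ n"
proof -
  interpret pair_graph G by fact
  show ?thesis
    using assms(2)
  proof (induction n arbitrary: u)
    case 0
    then show ?case by (auto simp: awalk_Nil_iff)
  next
    case (Suc n)
    have "(\<exists>p. awalk u p v \<and> length p = Suc n)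
        \<longleftrightarrow> (\<exists>w p. (u, w) \<in> parcs G \<and> awalk w p v \<and> length p = n)"
    proof
      assume "\<exists>p. awalk u p v \<and> length p = Suc n"
      then obtain e p where "awalk u (e # p) v" "length p = n" by (metis length_Suc_conv)
      then show "\<exists>w p. (u, w) \<in> parcs G \<and> awalk w p v \<and> length p = n"
        by (intro exI[of _ "snd e"] exI[of _ p]) (auto simp: awalk_Cons_iff)
    next
      assume "\<exists>w p. (u, w) \<in> parcs G \<and> awalk w p v \<and> length p = n"
      then obtain w p where "(u, w) \<in> parcs G" "awalk w p v" "length p = n" by blast
      then show "\<exists>p. awalk u p v \<and> length p = Suc n"
        by (intro exI[of _ "(u, w) # p"]) (auto simp: awalk_Cons_iff)
    qed
    also have "\<dots> \<longleftrightarrow> (\<exists>w. (u, w) \<in> parcs G \<and> (w, v) \<in> parcs G ^^ n)"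
      using Suc.IH in_arcsD2 by blast
    also have "\<dots> \<longleftrightarrow> (u, v) \<in> parcs G ^^ Suc n"
      by (meson relpow_Suc_D2 relpow_Suc_I2)
    finally show ?case .
  qed
qed

text \<open>\<open>\<mu>\<close> is an infimum of walk costs in the extended reals. It is attained
  by a shortest walk, hence finite, and \<open>real_of_ereal\<close> loses nothing.\<close>

lemma gdist_eq_rdist:
  assumes "pair_graph G" "u \<in> pverts G" "(u, v) \<in> (parcs G)\<^sup>*"
  shows "gdist G u v = real (rdist (parcs G) u v)"
proof -
  interpret pair_graph G by fact
  have cost: "awalk_cost (\<lambda>_. 1) p = real (length p)" for p :: "('a \<times> 'a) awalk"
    by (induction p) (simp_all add: awalk_cost_def)
  have "(u, v) \<in> parcs G ^^ rdist (parcs G) u v"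
    unfolding rdist_def using assms(3) rtrancl_imp_relpow by (metis LeastI_ex)
  then obtain p where p: "awalk u p v" "length p = rdist (parcs G) u v"
    using awalk_length_iff_relpow[OF assms(1,2)] by blast
  have "\<mu> (\<lambda>_. 1) u v = ereal (real (rdist (parcs G) u v))"
    unfolding \<mu>_def cost
  proof (rule antisym)
    show "(INF p\<in>{p. awalk u p v}. ereal (real (length p))) \<le> ereal (real (rdist (parcs G) u v))"
      by (rule INF_lower2[of p]) (use p in auto)
    show "ereal (real (rdist (parcs G) u v)) \<le> (INF p\<in>{p. awalk u p v}. ereal (real (length p)))"
    proof (rule INF_greatest)
      fix q assume "q \<in> {p. awalk u p v}"
      then have "(u, v) \<in> parcs G ^^ length q"
        using awalk_length_iff_relpow[OF assms(1,2)] by blast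
      from rdist_le[OF this] show "ereal (real (rdist (parcs G) u v)) \<le> ereal (real (length q))"
        by simp
    qed
  qed
  then show ?thesis unfolding gdist_def by simp
qed

text \<open>Ordered pairs are grouped by their underlying set; each two-element set arises exactly
  twice.\<close>

lemma sum_doubletons:
  fixes h :: "'a set \<Rightarrow> real"
  assumes "finite V"
  shows "2 * (\<Sum>e | e \<subseteq> V \<and> card e = 2. h e) = (\<Sum>u\<in>V. \<Sum>v\<in>V. if u = v then 0 else h {u, v})"
proof -
  define S where "S = {x \<in> V \<times> V. fst x \<noteq> snd x}"
  define T where "T = {e. e \<subseteq> V \<and> card e = 2}"
  have fin: "finite S" "finite T" using assms by (auto simp: S_def T_def)
  have "(\<Sum>u\<in>V. \<Sum>v\<in>V. if u = v then 0 else h {u, v})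
      = (\<Sum>x\<in>V \<times> V. if fst x = snd x then 0 else h {fst x, snd x})"
    by (simp add: sum.cartesian_product split_beta)
  also have "\<dots> = (\<Sum>x\<in>S. h {fst x, snd x})"
    by (rule sum.mono_neutral_cong_right) (use assms in \<open>auto simp: S_def\<close>)
  also have "\<dots> = (\<Sum>e\<in>T. \<Sum>x | x \<in> S \<and> {fst x, snd x} = e. h {fst x, snd x})"
    by (rule sum.group[OF fin, symmetric]) (auto simp: S_def T_def)
  also have "\<dots> = (\<Sum>e\<in>T. 2 * h e)"
  proof (rule sum.cong[OF refl])
    fix e assume "e \<in> T"
    then obtain a b where ab: "e = {a, b}" "a \<noteq> b" "a \<in> V" "b \<in> V"
      by (auto simp: T_def card_2_iff)
    then have "{x \<in> S. {fst x, snd x} = e} = {(a, b), (b, a)}"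
      by (auto simp: S_def doubleton_eq_iff)
    then show "(\<Sum>x | x \<in> S \<and> {fst x, snd x} = e. h {fst x, snd x}) = 2 * h e"
      using ab by (simp add: insert_commute)
  qed
  finally show ?thesis by (simp add: T_def sum_distrib_left)
qed

text \<open>Passing to ordered pairs allows sums over products; \<open>f 0 = 0\<close> makes the
  diagonal harmless.\<close>

lemma wiener_eq_pair_sum:
  assumes "pair_graph G" "connected_ugraph (pverts G) (parcs G)" "f 0 = 0"
  shows "2 * wiener f G = (\<Sum>u\<in>pverts G. \<Sum>v\<in>pverts G. f (real (rdist (parcs G) u v)))"
proof -
  interpret connected_ugraph "pverts G" "parcs G" by fact
  show ?thesis
    unfolding wiener_def sum_doubletons[OF finite_V] pair_dist_doubleton[OF assms(1)]
    by (intro sum.cong refl) (simp add: assms(3) gdist_eq_rdist[OF assms(1) _ reach])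
qed

section \<open>From pair graphs to edge relations, and digraph isomorphisms\<close>

lemma pair_graph_basic:
  assumes "pair_graph G"
  shows "finite (pverts G)" "parcs G \<subseteq> pverts G \<times> pverts G" "sym (parcs G)" "(u, u) \<notin> parcs G"
proof -
  interpret pair_graph G by fact
  show "finite (pverts G)" by (rule pair_finite_verts)
  show "parcs G \<subseteq> pverts G \<times> pverts G" using in_arcsD1 in_arcsD2 by auto
  show "sym (parcs G)" using pair_sym_arcs by (simp add: symmetric_def)
  show "(u, u) \<notin> parcs G" using pair_no_loops by fastforce
qed

text \<open>Connectedness of a digraph means strong connectedness of its symmetric closure, which
  has the same arcs when the arc set is already symmetric.\<close>

lemma connected_ugraph_pair_graph:
  assumes "pair_graph G" "Digraph_Component.connected (with_proj G)"
  shows "connected_ugraph (pverts G) (parcs G)"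
proof
  interpret pair_graph G by fact
  fix u v assume "u \<in> pverts G" "v \<in> pverts G"
  then have "u \<rightarrow>\<^sup>*\<^bsub>with_proj (mk_symmetric (with_proj G))\<^esub> v"
    using assms(2) by (simp add: Digraph_Component.connected_def strongly_connected_def)
  then have "(u, v) \<in> (parcs (mk_symmetric (with_proj G)))\<^sup>*"
    by (metis reachable_rtranclI with_proj_simps(3))
  then show "(u, v) \<in> (parcs G)\<^sup>*"
    using adj_mk_symmetric_eq[OF pair_sym_arcs] by simp
qed (use pair_graph_basic[OF assms(1)] in auto)

lemma digraph_iso_imp_bij:
  assumes "digraph_iso (with_proj G) (with_proj H)"
  obtains \<phi> where "bij_betw \<phi> (pverts G) (pverts H)"
    and "\<And>u v. (u, v) \<in> parcs G \<Longrightarrow> (\<phi> u, \<phi> v) \<in> parcs H"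
proof -
  obtain hom where hom: "pre_digraph.digraph_isomorphism (with_proj G) hom"
    and H: "with_proj H = app_iso hom (with_proj G)"
    using assms by (auto simp: digraph_iso_def)
  have V: "pverts H = iso_verts hom ` pverts G" and A: "parcs H = iso_arcs hom ` parcs G"
    \<comment> \<open>\<open>app_iso\<close> installs the tail and head maps of \<open>hom\<close>,
      so equality with \<open>with_proj H\<close> forces them to be the projections.\<close>
    and ht: "iso_tail hom = fst" "iso_head hom = snd"
    using H by (auto simp: app_iso_def with_proj_def)
  show thesis
  proof
    show "bij_betw (iso_verts hom) (pverts G) (pverts H)"
      using hom V by (simp add: pre_digraph.digraph_isomorphism_def bij_betw_def)
    fix u v assume e: "(u, v) \<in> parcs G"
    then have "iso_verts hom u = fst (iso_arcs hom (u, v))" "iso_verts hom v = snd (iso_arcs hom (u, v))"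
      using hom ht by (auto simp: pre_digraph.digraph_isomorphism_def)
    with e A show "(iso_verts hom u, iso_verts hom v) \<in> parcs H" by auto
  qed
qed

lemma digraph_iso_if_bij:
  assumes "pair_graph G" "parcs H \<subseteq> pverts H \<times> pverts H" "bij_betw \<phi> (pverts G) (pverts H)"
    and adj: "\<And>u v. u \<in> pverts G \<Longrightarrow> v \<in> pverts G \<Longrightarrow> (u, v) \<in> parcs G \<longleftrightarrow> (\<phi> u, \<phi> v) \<in> parcs H"
  shows "digraph_iso (with_proj G) (with_proj H)"
proof -
  interpret pair_graph G by fact
  define hom where "hom = \<lparr>iso_verts = \<phi>, iso_arcs = map_prod \<phi> \<phi>, iso_head = snd, iso_tail = fst\<rparr>"
  have inj: "inj_on \<phi> (pverts G)" and V: "\<phi> ` pverts G = pverts H"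
    using assms(3) by (auto simp: bij_betw_def)
  have "inj_on (map_prod \<phi> \<phi>) (parcs G)"
    using map_prod_inj_on[OF inj inj] pair_graph_basic(2)[OF assms(1)] inj_on_subset by blast
  then have "digraph_isomorphism hom"
    using inj wf_digraph_axioms by (simp add: digraph_isomorphism_def hom_def)
  moreover have "map_prod \<phi> \<phi> ` parcs G = parcs H"
  proof
    show "map_prod \<phi> \<phi> ` parcs G \<subseteq> parcs H"
      using adj pair_graph_basic(2)[OF assms(1)] by auto
    show "parcs H \<subseteq> map_prod \<phi> \<phi> ` parcs G"
    proof
      fix x assume x: "x \<in> parcs H"
      then obtain u v where "u \<in> pverts G" "v \<in> pverts G" "x = (\<phi> u, \<phi> v)"
        using assms(2) unfolding V[symmetric] by auto
      with x adj show "x \<in> map_prod \<phi> \<phi> ` parcs G" by (metis image_eqI map_prod_simp)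
    qed
  qed
  then have "with_proj H = app_iso hom (with_proj G)"
    using V by (simp add: app_iso_def with_proj_def hom_def)
  ultimately show ?thesis unfolding digraph_iso_def by blast
qed

lemma relpow_map:
  assumes "\<And>u v. (u, v) \<in> E \<Longrightarrow> (\<phi> u, \<phi> v) \<in> E'" "(u, v) \<in> E ^^ n"
  shows "(\<phi> u, \<phi> v) \<in> E' ^^ n"
  using assms(2)
proof (induction n arbitrary: v)
  case (Suc n)
  then obtain w where "(u, w) \<in> E ^^ n" "(w, v) \<in> E" by auto
  with Suc.IH assms(1) show ?case by (metis relpow_Suc_I)
qed simp

section \<open>The extremal tree\<close>

text \<open>Each edge is listed from its smaller vertex and without floors or ceilings, so that
  adjacency goals are linear arithmetic.\<close>

definition broom_adj :: "nat \<Rightarrow> nat \<Rightarrow> nat \<Rightarrow> nat \<Rightarrow> nat \<Rightarrow> bool" where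
  "broom_adj n k p u v \<longleftrightarrow> Suc u = v \<and> v < k \<or> u = 0 \<and> k \<le> v \<and> v < k + p
     \<or> u = k - 1 \<and> k + p \<le> v \<and> v < n"

lemma parcs_A_tree:
  assumes "1 \<le> m" "2 * m \<le> n"
  defines "k \<equiv> 2 * m - 1"
  defines "p \<equiv> (n - k + 1) div 2"
  shows "(u, v) \<in> parcs (A_tree n m) \<longleftrightarrow> broom_adj n k p u v \<or> broom_adj n k p v u"
proof -
  define z where "z = int n - 2 * int m + 1"
  have z: "(real n - 2 * real m + 1) / 2 = real_of_int z / real_of_int 2"
    by (simp add: z_def)
  have fl: "\<lfloor>(real n - 2 * real m + 1) / 2\<rfloor> = z div 2"
    unfolding z by (rule floor_divide_of_int_eq)
  have ce: "\<lceil>(real n - 2 * real m + 1) / 2\<rceil> = - ((- z) div 2)"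
    unfolding z by (rule ceiling_divide_eq_div)
  have p: "nat (- ((- z) div 2)) = p" and q: "k + p + nat (z div 2) = n"
    using assms unfolding z_def by linarith+
  show ?thesis
    unfolding A_tree_def Let_def fl ce p k_def[symmetric] q by (auto simp: broom_adj_def)
qed

locale balanced_broom =
  fixes n m k p :: nat
  assumes m_pos: "1 \<le> m" and m_le: "2 * m \<le> n" and k_def: "k = 2 * m - 1"
    and p_def: "p = (n - k + 1) div 2"
begin

abbreviation "A \<equiv> A_tree n m"

lemma k_pos: "0 < k" and k_less: "k < n" and p_le: "k + p \<le> n"
  using m_pos m_le k_def p_def by auto

lemma adj_A: "(u, v) \<in> parcs A \<longleftrightarrow> broom_adj n k p u v \<or> broom_adj n k p v u"
  using parcs_A_tree[OF m_pos m_le] unfolding k_def p_def .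

lemma verts_A: "pverts A = {..<n}"
  by (rule pverts_A_tree[OF m_pos m_le])

lemma pair_graph_A: "pair_graph A"
  by (rule pair_graph_A_tree[OF m_pos m_le])

lemma reach_0:
  assumes "v < n"
  shows "(0, v) \<in> (parcs A)\<^sup>*"
proof -
  have path: "(0, i) \<in> (parcs A)\<^sup>*" if "i < k" for i
    using that
  proof (induction i)
    case (Suc i)
    then have "(i, Suc i) \<in> parcs A" by (simp add: adj_A broom_adj_def)
    with Suc show ?case by (meson Suc_lessD rtrancl.rtrancl_into_rtrancl)
  qed simp
  consider "v < k" | "k \<le> v" "v < k + p" | "k + p \<le> v" by linarith
  then show ?thesis
  proof cases
    case 1
    then show ?thesis by (rule path)
  next
    case 2
    then have "(0, v) \<in> parcs A" by (simp add: adj_A broom_adj_def)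
    then show ?thesis by blast
  next
    case 3
    then have "(k - 1, v) \<in> parcs A" using assms by (simp add: adj_A broom_adj_def)
    then show ?thesis using path[of "k - 1"] k_pos by (simp add: rtrancl.rtrancl_into_rtrancl)
  qed
qed

sublocale A: connected_ugraph "pverts A" "parcs A"
proof
  fix u v assume "u \<in> pverts A" "v \<in> pverts A"
  then have "(0, u) \<in> (parcs A)\<^sup>*" "(0, v) \<in> (parcs A)\<^sup>*" using reach_0 verts_A by auto
  then show "(u, v) \<in> (parcs A)\<^sup>*"
    using sym_rtrancl[OF pair_graph_basic(3)[OF pair_graph_A]] by (meson rtrancl_trans symD)
qed (use pair_graph_basic[OF pair_graph_A] in auto)

text \<open>The tree is projected to the integers from \<open>-1\<close> to \<open>k\<close>, with
  the pendent classes just beyond the ends of the path. Each edge moves the position by one, so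
  differences of positions bound distances from below.\<close>

definition pos :: "nat \<Rightarrow> int" where
  "pos x = (if x < k then int x else if x < k + p then -1 else int k)"

lemma pos_relpow: "(u, v) \<in> parcs A ^^ j \<Longrightarrow> \<bar>pos u - pos v\<bar> \<le> int j"
proof (induction j arbitrary: v)
  case (Suc j)
  then obtain w where w: "(u, w) \<in> parcs A ^^ j" "(w, v) \<in> parcs A" by auto
  have "\<bar>pos w - pos v\<bar> \<le> 1"
    using w(2) k_pos unfolding adj_A broom_adj_def pos_def by (auto split: if_splits)
  with Suc.IH[OF w(1)] show ?case by simp
qed simp

text \<open>This is the tree distance written out. The value 2 is for distinct pendent vertices at
  the same end, which \<open>pos\<close> does not separate.\<close>

definition low :: "nat \<Rightarrow> nat \<Rightarrow> nat" where
  "low x y = (if x = y then 0 else if k \<le> x \<and> k \<le> y \<and> pos x = pos y then 2 else nat \<bar>pos x - pos y\<bar>)"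

lemma low_le: "x < n \<Longrightarrow> y < n \<Longrightarrow> low x y \<le> rdist (parcs A) x y"
proof -
  assume xy: "x < n" "y < n"
  then have V: "x \<in> pverts A" "y \<in> pverts A" by (auto simp: verts_A)
  have "\<bar>pos x - pos y\<bar> \<le> int (rdist (parcs A) x y)"
    by (rule pos_relpow[OF A.relpow_d[OF V]])
  moreover have "2 \<le> rdist (parcs A) x y" if "x \<noteq> y" "k \<le> x" "k \<le> y"
  proof -
    have "(x, y) \<notin> parcs A" using that k_pos by (auto simp: adj_A broom_adj_def)
    then show ?thesis using A.d_eq_1[OF V] A.d_pos[OF V that(1)] by linarith
  qed
  ultimately show ?thesis by (auto simp: low_def)
qed

lemma low_pos: "x < n \<Longrightarrow> y < n \<Longrightarrow> x \<noteq> y \<Longrightarrow> 0 < low x y"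
  by (auto simp: low_def pos_def split: if_splits)

text \<open>The pair sum taken with \<open>low\<close> is exactly \<open>extremal_sum\<close>;
  monotonicity then passes from \<open>low\<close> to the distance. \<open>low_pos\<close> keeps the
  arguments off 0, where monotonicity may fail.\<close>

lemma extremal_sum_le:
  assumes F_0: "F 0 = 0" and F_mono: "\<And>i j. 0 < i \<Longrightarrow> i \<le> j \<Longrightarrow> F i \<le> F j"
  shows "extremal_sum F k (n - k) \<le> (\<Sum>x\<in>pverts A. \<Sum>y\<in>pverts A. F (rdist (parcs A) x y))"
proof -
  let ?l = "n - k"
  define P where "P = {k..<k + p}"
  define Q where "Q = {k + p..<n}"
  define L where "L = {k..<n}"
  have PQ: "P \<subseteq> L" "Q \<subseteq> L" "finite L" and card: "card P = p" "card Q = ?l - p" "card L = ?l"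
    using p_le by (auto simp: P_def Q_def L_def)
  \<comment> \<open>A balanced split attains the floor in
    \<open>mult_diff_le_sq_div4\<close>.\<close>
  have "p * (?l - p) = ?l\<^sup>2 div 4"
  proof (cases "even ?l")
    case True
    then obtain a where a: "?l = 2 * a" by blast
    then have "p = a" using p_def by simp
    then show ?thesis using a by (simp add: power2_eq_square)
  next
    case False
    then obtain a where a: "?l = 2 * a + 1" by (rule oddE)
    then have "p = a + 1" using p_def by simp
    moreover have "(2 * a + 1)\<^sup>2 = 1 + 4 * ((a + 1) * a)" by (simp add: power2_eq_square algebra_simps)
    ultimately show ?thesis using a by (simp only:) simp
  qed
  then have pq: "card P * card Q = ?l\<^sup>2 div 4" using card by simp
  have split: "(\<Sum>x<n. h x) = (\<Sum>x<k. h x) + (\<Sum>x\<in>L. h x)" for h :: "nat \<Rightarrow> real"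
    using sum.atLeastLessThan_concat[of 0 k n h] k_less by (simp add: L_def lessThan_atLeast0)
  have low_commute: "low x y = low y x" for x y by (auto simp: low_def abs_minus_commute)
  have leaf: "(\<Sum>w<k. F (low u w)) = (\<Sum>i<k. F (Suc i))" if u: "u \<in> L" for u
  proof (cases "u < k + p")
    case True
    then have "low u w = Suc w" if "w < k" for w using that u by (auto simp: low_def pos_def L_def)
    then show ?thesis by simp
  next
    case False
    then have "low u w = Suc (k - Suc w)" if "w < k" for w
      using that u by (auto simp: low_def pos_def L_def)
    then have "(\<Sum>w<k. F (low u w)) = (\<Sum>w<k. F (Suc (k - Suc w)))" by simp
    also have "\<dots> = (\<Sum>i<k. F (Suc i))" by (rule sum.nat_diff_reindex)
    finally show ?thesis .
  qed
  have "F (low u v) = F 2 * of_bool (u \<noteq> v) + (F (Suc k) - F 2)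
      * (of_bool (u \<in> P \<and> v \<in> Q) + of_bool (u \<in> Q \<and> v \<in> P))" if uv: "u \<in> L" "v \<in> L" for u v
  proof -
    have "nat (1 + int k) = Suc k" by simp
    then show ?thesis
      using uv F_0 k_pos by (auto simp: low_def pos_def P_def Q_def L_def add.commute)
  qed
  then have "(\<Sum>u\<in>L. \<Sum>v\<in>L. F (low u v)) = (\<Sum>u\<in>L. \<Sum>v\<in>L. F 2 * of_bool (u \<noteq> v)
      + (F (Suc k) - F 2) * (of_bool (u \<in> P \<and> v \<in> Q) + of_bool (u \<in> Q \<and> v \<in> P)))"
    by simp
  also have "\<dots> = F 2 * (\<Sum>u\<in>L. \<Sum>v\<in>L. of_bool (u \<noteq> v)) + (F (Suc k) - F 2)
      * (real (\<Sum>u\<in>L. \<Sum>v\<in>L. of_bool (u \<in> P \<and> v \<in> Q))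
        + real (\<Sum>u\<in>L. \<Sum>v\<in>L. of_bool (u \<in> Q \<and> v \<in> P)))"
    by (simp only: sum.distrib sum_distrib_left distrib_left of_nat_sum of_nat_of_bool)
  also have "\<dots> = real ?l * (real ?l - 1) * F 2 + (F (Suc k) - F 2) * real (2 * (?l\<^sup>2 div 4))"
    unfolding sum_of_bool_neq[OF PQ(3)] sum_of_bool_product[OF PQ(3,1,2)]
      sum_of_bool_product[OF PQ(3,2,1)] pq mult.commute[of "card Q"] card(3)
    by (simp only: mult_2 of_nat_add mult.commute)
  finally have LL: "(\<Sum>u\<in>L. \<Sum>v\<in>L. F (low u v))
      = real ?l * (real ?l - 1) * F 2 + (F (Suc k) - F 2) * real (2 * (?l\<^sup>2 div 4))" .
  have "(\<Sum>x<k. \<Sum>y\<in>L. F (low x y)) = (\<Sum>u\<in>L. \<Sum>w<k. F (low u w))"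
    by (subst sum.swap) (simp add: low_commute)
  moreover have "(\<Sum>u\<in>L. \<Sum>w<k. F (low u w)) = real ?l * (\<Sum>i<k. F (Suc i))"
    using leaf card by simp
  moreover have "(\<Sum>x<k. \<Sum>y<k. F (low x y)) = (\<Sum>x<k. \<Sum>y<k. F (nat \<bar>int x - int y\<bar>))"
    by (intro sum.cong refl) (auto simp: low_def pos_def)
  ultimately have "extremal_sum F k ?l = (\<Sum>x<n. \<Sum>y<n. F (low x y))"
    unfolding extremal_sum_def split sum.distrib LL by simp
  also have "\<dots> \<le> (\<Sum>x<n. \<Sum>y<n. F (rdist (parcs A) x y))"
  proof (intro sum_mono)
    fix x y assume "x \<in> {..<n}" "y \<in> {..<n}"
    then show "F (low x y) \<le> F (rdist (parcs A) x y)"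
      using low_le[of x y] low_pos[of x y] F_mono by (cases "x = y") (auto simp: low_def)
  qed
  finally show ?thesis by (simp add: verts_A)
qed

end

section \<open>Recognising the extremal tree up to isomorphism\<close>

context balanced_broom
begin

text \<open>The map \<open>\<psi>\<close> from the tree to \<open>G\<close> follows \<open>c\<close>
  on the path and uses arbitrary bijections on the two pendent classes, whose members are
  interchangeable. Its inverse is the isomorphism.\<close>

lemma digraph_iso_if_double_broom:
  assumes G: "pair_graph G" and K: "K \<subseteq> pverts G" and c: "bij_betw c {..<k} K"
    and path: "\<And>i j. i < k \<Longrightarrow> j < k \<Longrightarrow> (c i, c j) \<in> parcs G \<longleftrightarrow> i = Suc j \<or> j = Suc i"
    and L: "pverts G - K = L1 \<union> L2" "L1 \<inter> L2 = {}" "card L1 = p" "card L2 = n - (k + p)"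
    and indep: "\<And>u v. u \<in> pverts G - K \<Longrightarrow> v \<in> pverts G - K \<Longrightarrow> (u, v) \<notin> parcs G"
    and adj1: "\<And>u i. u \<in> L1 \<Longrightarrow> i < k \<Longrightarrow> (u, c i) \<in> parcs G \<longleftrightarrow> i = 0"
    and adj2: "\<And>u i. u \<in> L2 \<Longrightarrow> i < k \<Longrightarrow> (u, c i) \<in> parcs G \<longleftrightarrow> i = k - 1"
  shows "digraph_iso (with_proj G) (with_proj A)"
proof -
  have sym: "(u, v) \<in> parcs G \<longleftrightarrow> (v, u) \<in> parcs G" for u v
    using pair_graph_basic(3)[OF G] by (meson symD)
  have "finite (L1 \<union> L2)" using pair_graph_basic(1)[OF G] unfolding L(1)[symmetric] by simp
  then have fin: "finite L1" "finite L2" by auto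
  obtain g1 where g1: "bij_betw g1 {k..<k + p} L1"
    using finite_same_card_bij[of "{k..<k + p}" L1] fin L(3) by auto
  obtain g2 where g2: "bij_betw g2 {k + p..<n} L2"
    using finite_same_card_bij[of "{k + p..<n}" L2] fin L(4) by auto
  define \<psi> where "\<psi> i = (if i < k then c i else if i < k + p then g1 i else g2 i)" for i
  have "bij_betw \<psi> {..<k} K" using c by (rule bij_betw_cong[THEN iffD1, rotated]) (simp add: \<psi>_def)
  moreover have "bij_betw \<psi> {k..<k + p} L1"
    using g1 by (rule bij_betw_cong[THEN iffD1, rotated]) (simp add: \<psi>_def)
  moreover have "bij_betw \<psi> {k + p..<n} L2"
    using g2 by (rule bij_betw_cong[THEN iffD1, rotated]) (simp add: \<psi>_def)
  ultimately have "bij_betw \<psi> ({..<k} \<union> ({k..<k + p} \<union> {k + p..<n})) (K \<union> (L1 \<union> L2))"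
    using L(1,2) by (intro bij_betw_combine) auto
  moreover have "{..<k} \<union> ({k..<k + p} \<union> {k + p..<n}) = {..<n}" using p_le by auto
  moreover have "K \<union> (L1 \<union> L2) = pverts G" using L(1) K by auto
  ultimately have bij: "bij_betw \<psi> {..<n} (pverts G)" by simp
  have le: "(\<psi> i, \<psi> j) \<in> parcs G \<longleftrightarrow> (i, j) \<in> parcs A" if ij: "i \<le> j" "j < n" for i j
  proof -
    have leaf: "\<psi> x \<in> L1 \<union> L2" "x < k + p \<Longrightarrow> \<psi> x \<in> L1" "k + p \<le> x \<Longrightarrow> \<psi> x \<in> L2"
      if "k \<le> x" "x < n" for x
      using that g1 g2 by (auto simp: \<psi>_def bij_betw_def)
    consider "j < k" | "i < k" "k \<le> j" "j < k + p" | "i < k" "k + p \<le> j" | "k \<le> i"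
      by linarith
    then show ?thesis
    proof cases
      case 1
      then show ?thesis using ij path[of i j] by (auto simp: \<psi>_def adj_A broom_adj_def)
    next
      case 2
      then have "(\<psi> i, \<psi> j) \<in> parcs G \<longleftrightarrow> i = 0"
        using adj1[of "\<psi> j" i] leaf(2)[of j] ij sym by (simp add: \<psi>_def)
      moreover have "(i, j) \<in> parcs A \<longleftrightarrow> i = 0"
        using 2 k_pos unfolding adj_A broom_adj_def by linarith
      ultimately show ?thesis by simp
    next
      case 3
      then have "(\<psi> i, \<psi> j) \<in> parcs G \<longleftrightarrow> i = k - 1"
        using adj2[of "\<psi> j" i] leaf(3)[of j] ij sym by (simp add: \<psi>_def)
      moreover have "(i, j) \<in> parcs A \<longleftrightarrow> i = k - 1"
        using 3 k_pos ij unfolding adj_A broom_adj_def by linarith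
      ultimately show ?thesis by simp
    next
      case 4
      then have "(\<psi> i, \<psi> j) \<notin> parcs G" using indep leaf(1) ij unfolding L(1) by simp
      moreover have "(i, j) \<notin> parcs A" using 4 k_pos ij unfolding adj_A broom_adj_def by linarith
      ultimately show ?thesis by simp
    qed
  qed
  have \<psi>_adj: "(\<psi> i, \<psi> j) \<in> parcs G \<longleftrightarrow> (i, j) \<in> parcs A" if "i < n" "j < n" for i j
  proof (cases "i \<le> j")
    case True
    then show ?thesis using le that by blast
  next
    case False
    then have "(\<psi> j, \<psi> i) \<in> parcs G \<longleftrightarrow> (j, i) \<in> parcs A" using le[of j i] that by simp
    then show ?thesis using sym[of "\<psi> i" "\<psi> j"] A.E_commute[of i j] by blast
  qed
  define \<phi> where "\<phi> = inv_into {..<n} \<psi>"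
  have \<phi>: "bij_betw \<phi> (pverts G) (pverts A)"
    unfolding \<phi>_def verts_A by (rule bij_betw_inv_into[OF bij])
  have inv: "\<psi> (\<phi> u) = u" "\<phi> u < n" if "u \<in> pverts G" for u
    using bij_betw_inv_into_right[OF bij that] bij_betwE[OF \<phi>] that verts_A by (auto simp: \<phi>_def)
  show ?thesis
  proof (rule digraph_iso_if_bij[OF G A.E_subset \<phi>])
    fix u v assume "u \<in> pverts G" "v \<in> pverts G"
    then show "(u, v) \<in> parcs G \<longleftrightarrow> (\<phi> u, \<phi> v) \<in> parcs A"
      using \<psi>_adj[of "\<phi> u" "\<phi> v"] inv by simp
  qed
qed

end

section \<open>The core of the given graph, and the theorem\<close>

lemma independent_set_of_max_card:
  assumes "finite (pverts G)"
  obtains I where "independent_set G I" "card I = independence_number G"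
proof -
  have "{S. independent_set G S} \<subseteq> Pow (pverts G)" by (auto simp: independent_set_def)
  then have "finite (card ` {S. independent_set G S})"
    using assms by (meson finite_Pow_iff finite_imageI finite_subset)
  moreover have "independent_set G {}" by (simp add: independent_set_def)
  ultimately have "independence_number G \<in> card ` {S. independent_set G S}"
    unfolding independence_number_def by (intro Max_in) auto
  with that show thesis by auto
qed

lemma (in connected_ugraph) core_exists:
  assumes indep: "\<And>u v. u \<in> I \<Longrightarrow> v \<in> I \<Longrightarrow> (u, v) \<notin> E"
    and card: "card (V - I) = m" "1 \<le> m" "2 * m \<le> card V"
  obtains K s where "grown E K" "K \<subseteq> V" "card K = 2 * m - 1" "V - K \<subseteq> I"
    and "\<And>u. u \<in> V - K \<Longrightarrow> s u \<in> K \<and> (s u, u) \<in> E"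
proof -
  have "V - I \<noteq> {}" using card(1,2) by (metis card.empty not_one_le_zero)
  from cover_in_grown[of I, OF indep this] obtain K0
    where K0: "grown E K0" "V - I \<subseteq> K0" "K0 \<subseteq> V" "card K0 + 1 \<le> 2 * m"
    unfolding card(1) by blast
  have "card K0 \<le> 2 * m - 1" "2 * m - 1 \<le> card V" using K0(4) card(3) by linarith+
  from grown_extend[OF K0(1,3) this] obtain K
    where K: "grown E K" "K0 \<subseteq> K" "K \<subseteq> V" "card K = 2 * m - 1"
    by blast
  have "\<exists>w. w \<in> K \<and> (w, u) \<in> E" if u: "u \<in> V - K" for u
  proof -
    \<comment> \<open>Since \<open>V\<close> has at least two vertices, \<open>u\<close> has a
      neighbour; \<open>u\<close> lies in \<open>I\<close>, so this neighbour lies in the cover and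
      therefore in \<open>K\<close>.\<close>
    have "card {u} \<noteq> card V" using card by simp
    then have "{u} \<noteq> V" by metis
    then obtain a z where "a \<in> {u}" "z \<in> V - {u}" "(a, z) \<in> E"
      using edge_leaving[of "{u}"] u by blast
    moreover have "u \<in> I" using u K(2) K0(2) by auto
    ultimately show ?thesis using indep[of u z] K(2) K0(2) E_commute by blast
  qed
  then obtain s where "\<And>u. u \<in> V - K \<Longrightarrow> s u \<in> K \<and> (s u, u) \<in> E" by metis
  with that K K0(2) show thesis by blast
qed

theorem theorem7:
  fixes f :: "real \<Rightarrow> real" and G :: "'a pair_pre_digraph" and n \<alpha> :: nat
  assumes "convex_on {0..} f" and "f 0 = 0" and "strict_mono_on {0<..} f"
    and "pair_graph G" and "Digraph_Component.connected (with_proj G)"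
    and "card (pverts G) = n" and "independence_number G = \<alpha>"
    and "real \<alpha> \<le> real n - 1" and "real n / 2 \<le> real \<alpha>"
  shows "wiener f G \<le> wiener f (A_tree n (n - \<alpha>)) \<and>
    (wiener f G = wiener f (A_tree n (n - \<alpha>))
      \<longleftrightarrow> digraph_iso (with_proj G) (with_proj (A_tree n (n - \<alpha>))))"
proof -
  define m where "m = n - \<alpha>"
  define k where "k = 2 * m - 1"
  define F where "F i = f (real i)" for i :: nat
  \<comment> \<open>The upper bound on \<open>\<alpha>\<close> gives the first inequality, the lower
    bound the second.\<close>
  have m: "1 \<le> m" "2 * m \<le> n" using assms(8,9) by (auto simp: m_def)
  interpret connected_ugraph "pverts G" "parcs G"
    by (rule connected_ugraph_pair_graph[OF assms(4,5)])
  interpret B: balanced_broom n m k "(n - k + 1) div 2"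
    by unfold_locales (use m k_def in auto)
  obtain I where I: "independent_set G I" "card I = \<alpha>"
    using independent_set_of_max_card[OF finite_V] assms(7) by metis
  have IV: "I \<subseteq> pverts G" and indep: "\<And>u v. u \<in> I \<Longrightarrow> v \<in> I \<Longrightarrow> (u, v) \<notin> parcs G"
    using I(1) by (auto simp: independent_set_def)
  have cI: "card (pverts G - I) = m"
    using card_Diff_subset[OF finite_subset[OF IV finite_V] IV] I(2) assms(6) m_def by simp
  have mG: "2 * m \<le> card (pverts G)" using m(2) assms(6) by simp
  obtain K s where K: "grown (parcs G) K" "K \<subseteq> pverts G" "card K = k" "pverts G - K \<subseteq> I"
    and s: "\<And>u. u \<in> pverts G - K \<Longrightarrow> s u \<in> K \<and> (s u, u) \<in> parcs G"
    unfolding k_def using core_exists[of I m, OF indep cI m(1) mG] by blast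
  have l: "card (pverts G - K) = n - k"
    using card_Diff_subset[OF grown_finite[OF K(1)] K(2)] K(3) assms(6) by simp
  have F_0: "F 0 = 0" using assms(2) by (simp add: F_def)
  have F_strict: "F i < F j" if "0 < i" "i < j" for i j
    using assms(3) that by (simp add: F_def strict_mono_onD)
  have F_mono: "F i \<le> F j" if "0 < i" "i \<le> j" for i j
    using F_strict[of i j] that by (cases "i = j") auto
  interpret D: core_decomposition "pverts G" "parcs G" K s F
  proof
    fix e j :: nat assume "e \<le> j"
    moreover have "convex_on {2..2 + real j} f" by (rule convex_on_subset[OF assms(1)]) auto
    ultimately show "F (2 + e) \<le> F 2 + (F (2 + j) - F 2) / real j * real e"
      using convex_onD_Icc'[of 2 "2 + real j" f "2 + real e"] by (simp add: F_def)
  qed (use K s F_0 F_strict in auto)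
  let ?A = "A_tree n m"
  have WG: "2 * wiener f G = (\<Sum>u\<in>pverts G. \<Sum>v\<in>pverts G. F (d u v))"
    using wiener_eq_pair_sum[of _ f, OF assms(4) connected_ugraph_axioms assms(2)] by (simp add: F_def)
  have WA: "2 * wiener f ?A = (\<Sum>u\<in>pverts ?A. \<Sum>v\<in>pverts ?A. F (rdist (parcs ?A) u v))"
    using wiener_eq_pair_sum[of _ f, OF B.pair_graph_A B.A.connected_ugraph_axioms assms(2)]
    by (simp add: F_def)
  have G_le: "2 * wiener f G \<le> extremal_sum F k (n - k)"
    using D.pair_sum_le_extremal unfolding WG K(3) l .
  have A_ge: "extremal_sum F k (n - k) \<le> 2 * wiener f ?A"
    unfolding WA by (rule B.extremal_sum_le[of F, OF F_0 F_mono])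
  \<comment> \<open>\<open>extremal_sum\<close> lies between the two Wiener sums, so their equality
    makes \<open>G\<close> attain it.\<close>
  have "digraph_iso (with_proj G) (with_proj ?A)" if "wiener f G = wiener f ?A"
  proof -
    have eq: "(\<Sum>u\<in>pverts G. \<Sum>v\<in>pverts G. F (d u v)) = extremal_sum F (card K) (card (pverts G - K))"
      using G_le A_ge that unfolding WG[symmetric] K(3) l by simp
    have ne: "pverts G - K \<noteq> {}" using l B.k_less by (metis card.empty zero_less_diff less_irrefl)
    obtain c L1 L2 where c: "bij_betw c {..<k} K"
      and path: "\<And>i j. i < k \<Longrightarrow> j < k \<Longrightarrow> (c i, c j) \<in> parcs G \<longleftrightarrow> i = Suc j \<or> j = Suc i"
      and L: "pverts G - K = L1 \<union> L2" "L1 \<inter> L2 = {}"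
        "card L1 = (n - k + 1) div 2" "card L2 = (n - k) div 2"
      and adj: "\<And>u i. u \<in> L1 \<Longrightarrow> i < k \<Longrightarrow> (u, c i) \<in> parcs G \<longleftrightarrow> i = 0"
        "\<And>u i. u \<in> L2 \<Longrightarrow> i < k \<Longrightarrow> (u, c i) \<in> parcs G \<longleftrightarrow> i = k - 1"
      by (rule D.double_broom[OF eq ne, unfolded K(3) l]) blast
    have cL2: "card L2 = n - (k + (n - k + 1) div 2)" using L(4) by linarith
    show ?thesis
      by (rule B.digraph_iso_if_double_broom[OF assms(4) K(2) c path L(1-3) cL2 _ adj])
        (use indep K(4) in auto)
  qed
  \<comment> \<open>An arc-preserving bijection cannot increase distances. Together with the upper
    bound for \<open>G\<close> this gives equality.\<close>
  moreover have "wiener f ?A \<le> wiener f G" if iso: "digraph_iso (with_proj G) (with_proj ?A)"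
  proof -
    obtain \<phi> where \<phi>: "bij_betw \<phi> (pverts G) (pverts ?A)"
      and hom: "\<And>u v. (u, v) \<in> parcs G \<Longrightarrow> (\<phi> u, \<phi> v) \<in> parcs ?A"
      using digraph_iso_imp_bij[OF iso] by metis
    have "2 * wiener f ?A = (\<Sum>u\<in>pverts G. \<Sum>v\<in>pverts G. F (rdist (parcs ?A) (\<phi> u) (\<phi> v)))"
      unfolding WA by (simp add: sum.reindex_bij_betw[OF \<phi>, symmetric])
    also have "\<dots> \<le> 2 * wiener f G"
      unfolding WG
    proof (intro sum_mono)
      fix u v assume uv: "u \<in> pverts G" "v \<in> pverts G"
      have "rdist (parcs ?A) (\<phi> u) (\<phi> v) \<le> d u v"
        by (rule rdist_le, rule relpow_map[OF hom relpow_d[OF uv]])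
      \<comment> \<open>Injectivity of \<open>\<phi>\<close> keeps the smaller distance positive, as
        \<open>F_mono\<close> requires.\<close>
      moreover have "0 < rdist (parcs ?A) (\<phi> u) (\<phi> v)" if "u \<noteq> v"
      proof -
        have "\<phi> u \<noteq> \<phi> v" using that \<phi> uv by (auto simp: bij_betw_def inj_on_def)
        then show ?thesis using B.A.d_pos[of "\<phi> u" "\<phi> v"] bij_betwE[OF \<phi>] uv by auto
      qed
      ultimately show "F (rdist (parcs ?A) (\<phi> u) (\<phi> v)) \<le> F (d u v)"
        using F_mono by (cases "u = v") auto
    qed
    finally show ?thesis by simp
  qed
  ultimately show ?thesis using G_le A_ge unfolding m_def by fastforce
qed

end
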